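(* Let $(G,g)$ be a semi-Riemannian Lie group with a semisimple subgroup $K=K_1\times\cdots\times K_n$ generating a left-invariant conformal foliation $\mathcal F$ on $G$. Let $\mathfrak g=\mathfrak k_1\oplus\cdots\oplus\mathfrak k_n\oplus\mathfrak m$ be an orthogonal decomposition of the Lie algebra $\mathfrak g$ of $G$, where $\mathfrak k_j$ is the Lie algebra of $K_j$ and $\mathfrak m$ is two-dimensional. For each $k$ let $\mathcal V_k$ be the integrable distribution generated by $\mathfrak k_k$, let $\mathcal V=\mathcal V_1\oplus\cdots\oplus\mathcal V_n$, and let $\mathcal H$ be its orthogonal complementary distribution, generated by $\mathfrak m$. Then for all $j\neq k$ we have $\mathcal V_j[\mathcal V_k,\mathcal H]=0$, i.e. the orthogonal projection onto $\mathcal V_j$ of $[E,F]$ vanishes for all $E\in\mathfrak k_k$ and $F\in\mathfrak m$.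
   Context: A semi-Riemannian Lie group $(G,g)$ is a Lie group with a left-invariant non-degenerate metric $g$ of arbitrary signature (with $\mathfrak m$ non-degenerate); its Lie algebra is identified with the left-invariant vector fields. $K$ generates the left-invariant foliation $\mathcal F$ by left translates of $K$, tangent to $\mathcal V$. With $\nabla$ the Levi-Civita connection and $\mathcal V$ also the orthogonal projection onto $\mathcal V$, $B^{\mathcal H}(E,F)=\tfrac12\mathcal V(\nabla_EF+\nabla_FE)$ for $E,F\in\mathcal H$; $\mathcal F$ is conformal if there is a vector field $V$ in $\mathcal V$ with $B^{\mathcal H}(E,F)=g(E,F)V$ for all $E,F\in\mathcal H$. *)

theory Defs
  imports "HOL-Analysis.Analysis"
begin

text \<open>Everything is left-invariant, so we work on the Lie algebra of G, modelled as a
finite-dimensional real vector space (type of class euclidean_space; its built-in inner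
product is NOT used) with a Lie bracket br and a left-invariant metric g.\<close>

definition lie_algebra :: "('a::real_vector \<Rightarrow> 'a \<Rightarrow> 'a) \<Rightarrow> bool" where
  "lie_algebra br \<longleftrightarrow> bilinear br \<and> (\<forall>x. br x x = 0) \<and>
     (\<forall>x y z. br x (br y z) + br y (br z x) + br z (br x y) = 0)"

definition semi_riem_metric :: "('a::real_vector \<Rightarrow> 'a \<Rightarrow> real) \<Rightarrow> bool" where
  "semi_riem_metric g \<longleftrightarrow> bilinear g \<and> (\<forall>x y. g x y = g y x) \<and>
     (\<forall>x. (\<forall>y. g x y = 0) \<longrightarrow> x = 0)"

definition lie_subalgebra :: "('a::real_vector \<Rightarrow> 'a \<Rightarrow> 'a) \<Rightarrow> 'a set \<Rightarrow> bool" where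
  "lie_subalgebra br S \<longleftrightarrow> subspace S \<and> (\<forall>x\<in>S. \<forall>y\<in>S. br x y \<in> S)"

definition lie_ideal_of :: "('a::real_vector \<Rightarrow> 'a \<Rightarrow> 'a) \<Rightarrow> 'a set \<Rightarrow> 'a set \<Rightarrow> bool" where
  "lie_ideal_of br S I \<longleftrightarrow> subspace I \<and> I \<subseteq> S \<and> (\<forall>x\<in>S. \<forall>y\<in>I. br x y \<in> I)"

fun derived_series :: "('a::real_vector \<Rightarrow> 'a \<Rightarrow> 'a) \<Rightarrow> 'a set \<Rightarrow> nat \<Rightarrow> 'a set" where
  "derived_series br I 0 = I"
| "derived_series br I (Suc m) =
     span {br x y | x y. x \<in> derived_series br I m \<and> y \<in> derived_series br I m}"

definition solvable_lie :: "('a::real_vector \<Rightarrow> 'a \<Rightarrow> 'a) \<Rightarrow> 'a set \<Rightarrow> bool" where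
  "solvable_lie br I \<longleftrightarrow> (\<exists>m. derived_series br I m = {0})"

definition semisimple_lie :: "('a::real_vector \<Rightarrow> 'a \<Rightarrow> 'a) \<Rightarrow> 'a set \<Rightarrow> bool" where
  "semisimple_lie br S \<longleftrightarrow> lie_subalgebra br S \<and>
     (\<forall>I. lie_ideal_of br S I \<and> solvable_lie br I \<longrightarrow> I = {0})"

text \<open>Levi-Civita connection on left-invariant fields, via the Koszul formula.\<close>
definition lc_nabla :: "('a::real_vector \<Rightarrow> 'a \<Rightarrow> 'a) \<Rightarrow> ('a \<Rightarrow> 'a \<Rightarrow> real) \<Rightarrow> 'a \<Rightarrow> 'a \<Rightarrow> 'a" where
  "lc_nabla br g X Y = (THE Z. \<forall>W. 2 * g Z W = g (br X Y) W - g (br Y W) X + g (br W X) Y)"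

definition orth_proj :: "('a::real_vector \<Rightarrow> 'a \<Rightarrow> real) \<Rightarrow> 'a set \<Rightarrow> 'a \<Rightarrow> 'a" where
  "orth_proj g S x = (THE y. y \<in> S \<and> (\<forall>z\<in>S. g (x - y) z = 0))"

definition sum_spaces :: "(nat \<Rightarrow> 'a::real_vector set) \<Rightarrow> nat \<Rightarrow> 'a set" where
  "sum_spaces k n = {\<Sum>j<n. xs j | xs. \<forall>j<n. xs j \<in> k j}"

text \<open>Second fundamental form of the horizontal distribution H (spanned by m),
  with vertical space Vsp.\<close>
definition BH :: "('a::real_vector \<Rightarrow> 'a \<Rightarrow> 'a) \<Rightarrow> ('a \<Rightarrow> 'a \<Rightarrow> real) \<Rightarrow> 'a set \<Rightarrow> 'a \<Rightarrow> 'a \<Rightarrow> 'a" where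
  "BH br g Vsp E F = (1/2) *\<^sub>R orth_proj g Vsp (lc_nabla br g E F + lc_nabla br g F E)"

definition conformal_foliation ::
  "('a::real_vector \<Rightarrow> 'a \<Rightarrow> 'a) \<Rightarrow> ('a \<Rightarrow> 'a \<Rightarrow> real) \<Rightarrow> 'a set \<Rightarrow> 'a set \<Rightarrow> bool" where
  "conformal_foliation br g Vsp m \<longleftrightarrow>
     (\<exists>V\<in>Vsp. \<forall>E\<in>m. \<forall>F\<in>m. BH br g Vsp E F = g E F *\<^sub>R V)"

end

theory Submission
  imports Defs
    "HOL-Computational_Algebra.Field_as_Ring"
    "HOL-Computational_Algebra.Polynomial_Factorial"
    "HOL-Computational_Algebra.Fundamental_Theorem_Algebra"
begin

text \<open>
  Write \<open>K\<close> for the sum of the \<open>k\<^sub>j\<close>. Modulo \<open>K\<close>, each \<open>ad W\<close> with \<open>W \<in> K\<close> acts on the plane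
  \<open>m\<close>, and conformality says that it acts by a conformal endomorphism. Conformal endomorphisms of
  a nondegenerate plane commute, so \<open>[K, K]\<close> acts trivially; as \<open>K\<close> is perfect, \<open>[K, m] \<subseteq> K\<close>. Hence
  every \<open>F \<in> m\<close> acts on \<open>K\<close> by a derivation, and a derivation preserves each ideal \<open>k\<^sub>l\<close> because
  \<open>k\<^sub>l\<close> is semisimple and so \<open>k\<^sub>l = [k\<^sub>l, k\<^sub>l]\<close>. Thus \<open>[k\<^sub>l, m] \<subseteq> k\<^sub>l\<close>, which is orthogonal to \<open>k\<^sub>j\<close>.

  That a Lie algebra without solvable ideals is perfect is the substantial input. It follows from
  nondegeneracy on \<open>K\<close> of the form \<open>tr (ad x ad y)\<close>, the trace being taken on the whole ambient Lie
  algebra: a functional on \<open>K\<close> that vanishes on \<open>[K, K]\<close> is represented by some \<open>z \<in> K\<close>, invariance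
  makes \<open>z\<close> central, and so \<open>z = 0\<close>.

  As to nondegeneracy, let \<open>P\<close> be a perfect subalgebra on which the form vanishes, and \<open>x \<in> P\<close>.
  Pairing \<open>D = ad x\<close> with the derivation that acts by the conjugate eigenvalue on each generalized
  eigenspace of \<open>D\<close> gives \<open>0 = \<Sum> \<bar>\<lambda>\<bar>\<^sup>2\<close>, so \<open>D\<close> is nilpotent; by Engel's theorem \<open>P = 0\<close>. Hence the
  radical of the form on \<open>K\<close> has no nonzero perfect subalgebra, is solvable, and vanishes.
\<close>

section \<open>Traces of endomorphisms\<close>

definition nilpotent_map :: "('b::zero \<Rightarrow> 'b) \<Rightarrow> bool" where
  "nilpotent_map f \<longleftrightarrow> (\<exists>n. \<forall>v. (f ^^ n) v = 0)"

locale fin_dim_space = finite_dimensional_vector_space scale Basis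
  for scale :: "'a::field \<Rightarrow> 'b::ab_group_add \<Rightarrow> 'b" (infixr \<open>*s\<close> 75) and Basis
begin

abbreviation endo :: "('b \<Rightarrow> 'b) \<Rightarrow> bool" where
  "endo \<equiv> Vector_Spaces.linear scale scale"

interpretation endo: vector_space_pair scale scale
  by unfold_locales

lemmas endo_add = endo.linear_add
  and endo_scale = endo.linear_scale
  and endo_diff = endo.linear_diff
  and endo_zero = endo.linear_0
  and endo_sum = endo.linear_sum
  and endo_subspace_image = endo.linear_subspace_image
  and endo_eq_0_on_span = endo.linear_eq_0_on_span

lemma endoI:
  "(\<And>x y. f (x + y) = f x + f y) \<Longrightarrow> (\<And>c x. f (c *s x) = c *s f x) \<Longrightarrow> endo f"
  by (simp add: Vector_Spaces.linear_iff vector_space_axioms)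

lemma endo_compose: "endo f \<Longrightarrow> endo h \<Longrightarrow> endo (\<lambda>v. f (h v))"
  by (rule endoI) (simp_all add: endo_add endo_scale)

definition trace_on :: "'b set \<Rightarrow> ('b \<Rightarrow> 'b) \<Rightarrow> 'a" where
  "trace_on C f = (\<Sum>c\<in>C. representation C (f c) c)"

abbreviation tr :: "('b \<Rightarrow> 'b) \<Rightarrow> 'a" where
  "tr \<equiv> trace_on Basis"

lemma representation_Basis_eqI:
  assumes "(\<Sum>b\<in>Basis. f b *s b) = v" "b \<in> Basis"
  shows "representation Basis v b = f b"
proof -
  have "representation Basis v b = (\<Sum>c\<in>Basis. f c * representation Basis c b)"
    unfolding assms(1)[symmetric]
    by (simp add: representation_sum representation_scale independent_Basis span_Basis)
  also have "\<dots> = (\<Sum>c\<in>Basis. if b = c then f c else 0)"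
    by (intro sum.cong) (auto simp: representation_basis independent_Basis)
  finally show ?thesis using assms(2) finite_Basis by simp
qed

lemma representation_endo:
  assumes C: "independent C" and C': "independent C'" and f: "endo f"
    and into: "f ` C' \<subseteq> span C" and v: "v \<in> span C'"
  shows "representation C (f v) c = (\<Sum>d\<in>C'. representation C' v d * representation C (f d) c)"
proof -
  have "f v = f (\<Sum>d\<in>C'. representation C' v d *s d)"
    using sum_representation_eq[OF C' v finiteI_independent[OF C']] by simp
  also have "\<dots> = (\<Sum>d\<in>C'. representation C' v d *s f d)"
    by (simp add: endo_sum[OF f] endo_scale[OF f])
  finally show ?thesis
    using into
    by (simp add: representation_sum representation_scale C span_scale image_subset_iff)
qed

lemma trace_on_compose_commute:
  assumes C: "independent C" "independent C'" and f: "endo f" and h: "endo h"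
    and fC: "f ` C \<subseteq> span C'" and hC': "h ` C' \<subseteq> span C"
  shows "trace_on C (\<lambda>v. h (f v)) = trace_on C' (\<lambda>v. f (h v))"
proof -
  have "trace_on C (\<lambda>v. h (f v))
      = (\<Sum>c\<in>C. \<Sum>d\<in>C'. representation C' (f c) d * representation C (h d) c)"
    unfolding trace_on_def
    using representation_endo[OF C h hC'] fC by (intro sum.cong) auto
  also have "\<dots> = (\<Sum>d\<in>C'. \<Sum>c\<in>C. representation C (h d) c * representation C' (f c) d)"
    by (subst sum.swap) (simp add: mult.commute)
  also have "\<dots> = trace_on C' (\<lambda>v. f (h v))"
    unfolding trace_on_def
    using representation_endo[OF C(2,1) f fC] hC' by (intro sum.cong) auto
  finally show ?thesis .
qed

lemma tr_commute: "endo f \<Longrightarrow> endo h \<Longrightarrow> tr (\<lambda>v. f (h v)) = tr (\<lambda>v. h (f v))"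
  by (rule trace_on_compose_commute) (simp_all add: independent_Basis span_Basis)

lemma trace_on_restrict:
  assumes "independent C" "independent C'" "endo f"
    and "span C' \<subseteq> span C" "\<And>v. v \<in> span C \<Longrightarrow> f v \<in> span C'"
  shows "trace_on C f = trace_on C' f"
  using trace_on_compose_commute[of C C' f "\<lambda>v. v"] assms span_base
  by (auto simp: endoI)

lemma trace_on_eq_card_if_identity:
  assumes "independent C" "\<And>c. c \<in> C \<Longrightarrow> f c = c"
  shows "trace_on C f = of_nat (card C)"
  using assms by (simp add: trace_on_def representation_basis)

lemma tr_idempotent:
  assumes f: "endo f" and idem: "\<And>v. f (f v) = f v"
  shows "tr f = of_nat (dim (range f))"
proof -
  obtain C where C: "C \<subseteq> range f" "independent C" "span C = range f" "card C = dim (range f)"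
    using basis_subspace_exists[OF endo_subspace_image[OF f subspace_UNIV]] by metis
  have "tr f = trace_on C f"
    by (rule trace_on_restrict) (use C f in \<open>auto simp: independent_Basis span_Basis\<close>)
  also have "\<dots> = of_nat (card C)"
    using C(1) idem by (intro trace_on_eq_card_if_identity C(2)) auto
  finally show ?thesis using C(4) by simp
qed

lemma trace_on_nilpotent:
  assumes "independent C" "endo f" "\<And>v. v \<in> span C \<Longrightarrow> f v \<in> span C"
    and "\<And>v. v \<in> span C \<Longrightarrow> (f ^^ n) v = 0"
  shows "trace_on C f = 0"
  using assms
proof (induction n arbitrary: C)
  case 0
  then have "C \<subseteq> {0}" using span_base by auto
  then have "C = {}" using dependent_zero[of C] 0 by blast
  then show ?case by (simp add: trace_on_def)
next
  case (Suc n)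
  obtain C' where C': "independent C'" "span C' = f ` span C"
    using basis_subspace_exists[OF endo_subspace_image[OF Suc.prems(2) subspace_span]] by metis
  have "trace_on C f = trace_on C' f"
    using C' Suc.prems by (intro trace_on_restrict) auto
  also have "\<dots> = 0"
  proof (rule Suc.IH[OF C'(1) Suc.prems(2)])
    show "f v \<in> span C'" if "v \<in> span C'" for v
      using that Suc.prems(3) unfolding C'(2) by auto
    show "(f ^^ n) v = 0" if "v \<in> span C'" for v
      using that Suc.prems(4) unfolding C'(2) by (auto simp: funpow_swap1)
  qed
  finally show ?case .
qed

lemma tr_nilpotent: "endo f \<Longrightarrow> nilpotent_map f \<Longrightarrow> tr f = 0"
  unfolding nilpotent_map_def
  using trace_on_nilpotent[OF independent_Basis] by (auto simp: span_Basis)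

lemma tr_add: "tr (\<lambda>v. f v + h v) = tr f + tr h"
  by (simp add: trace_on_def representation_add independent_Basis span_Basis sum.distrib)

lemma tr_diff: "tr (\<lambda>v. f v - h v) = tr f - tr h"
  by (simp add: trace_on_def representation_diff independent_Basis span_Basis sum_subtractf)

lemma tr_scale: "tr (\<lambda>v. c *s f v) = c * tr f"
  by (simp add: trace_on_def representation_scale independent_Basis span_Basis sum_distrib_left)

lemma tr_zero: "tr (\<lambda>v. 0) = 0"
  by (simp add: trace_on_def representation_zero)

lemma tr_sum: "tr (\<lambda>v. \<Sum>a\<in>A. f a v) = (\<Sum>a\<in>A. tr (f a))"
  by (induction A rule: infinite_finite_induct) (simp_all add: tr_zero tr_add)

end

section \<open>Polynomials in an endomorphism\<close>

locale endomorphism = fin_dim_space scale Basis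
  for scale :: "'a::field \<Rightarrow> 'b::ab_group_add \<Rightarrow> 'b" (infixr \<open>*s\<close> 75) and Basis +
  fixes D :: "'b \<Rightarrow> 'b"
  assumes endo_D: "endo D"
begin

definition poly_endo :: "'a poly \<Rightarrow> 'b \<Rightarrow> 'b" where
  "poly_endo p v = (\<Sum>i\<le>degree p. coeff p i *s (D ^^ i) v)"

lemma poly_endo_0 [simp]: "poly_endo 0 v = 0"
  by (simp add: poly_endo_def)

lemma poly_endo_pCons [simp]: "poly_endo (pCons a p) v = a *s v + D (poly_endo p v)"
proof -
  have "poly_endo (pCons a p) v = (\<Sum>i\<le>Suc (degree p). coeff (pCons a p) i *s (D ^^ i) v)"
    unfolding poly_endo_def by (rule sum.mono_neutral_left) (auto simp: degree_pCons_le coeff_eq_0)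
  also have "\<dots> = a *s v + D (poly_endo p v)"
    by (subst sum.atMost_Suc_shift)
      (simp add: poly_endo_def endo_sum[OF endo_D] endo_scale[OF endo_D])
  finally show ?thesis .
qed

lemma poly_endo_1 [simp]: "poly_endo 1 v = v"
  by (simp add: one_pCons endo_zero[OF endo_D])

lemma poly_endo_add: "poly_endo (p + q) v = poly_endo p v + poly_endo q v"
  by (induction p q rule: poly_induct2) (simp_all add: scale_left_distrib endo_add[OF endo_D])

lemma poly_endo_smult: "poly_endo (smult c p) v = c *s poly_endo p v"
  by (induction p) (simp_all add: scale_right_distrib endo_scale[OF endo_D])

lemma poly_endo_mult: "poly_endo (p * q) v = poly_endo p (poly_endo q v)"
  by (induction p) (simp_all add: poly_endo_add poly_endo_smult)

lemma poly_endo_diff: "poly_endo (p - q) v = poly_endo p v - poly_endo q v"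
  using poly_endo_add[of "p - q" q v] by simp

lemma poly_endo_sum: "poly_endo (sum p A) v = (\<Sum>a\<in>A. poly_endo (p a) v)"
  by (induction A rule: infinite_finite_induct) (simp_all add: poly_endo_add)

lemma poly_endo_monom: "poly_endo (monom c i) v = c *s (D ^^ i) v"
  by (induction i) (simp_all add: monom_0 monom_Suc endo_scale[OF endo_D] endo_zero[OF endo_D])

lemma poly_endo_power: "poly_endo (p ^ i) v = (poly_endo p ^^ i) v"
  by (induction i) (simp_all add: poly_endo_mult)

lemma endo_poly_endo: "endo (poly_endo p)"
proof (rule endoI)
  show "poly_endo p (x + y) = poly_endo p x + poly_endo p y" for x y
    by (induction p) (simp_all add: scale_right_distrib endo_add[OF endo_D])
  show "poly_endo p (c *s x) = c *s poly_endo p x" for c x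
    by (induction p) (simp_all add: scale_right_distrib endo_scale[OF endo_D] mult.commute)
qed

lemma poly_endo_dvd_eq_0: "p dvd q \<Longrightarrow> poly_endo p v = 0 \<Longrightarrow> poly_endo q v = 0"
  by (auto simp: dvd_def poly_endo_mult mult.commute[of p] endo_zero[OF endo_poly_endo])

lemma poly_endo_in_subspace:
  assumes "subspace S" "\<And>v. v \<in> S \<Longrightarrow> D v \<in> S" "v \<in> S"
  shows "poly_endo p v \<in> S"
  by (induction p) (simp_all add: assms subspace_0 subspace_add subspace_scale)

definition gen_eigenspace :: "'a \<Rightarrow> nat \<Rightarrow> 'b set" where
  "gen_eigenspace a i = {v. poly_endo ([:- a, 1:] ^ i) v = 0}"

lemma gen_eigenspace_0: "gen_eigenspace a 0 = {0}"
  by (simp add: gen_eigenspace_def)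

lemma mem_gen_eigenspace_Suc:
  "v \<in> gen_eigenspace a (Suc i) \<longleftrightarrow> poly_endo [:- a, 1:] v \<in> gen_eigenspace a i"
  unfolding gen_eigenspace_def power_Suc2 by (simp only: mem_Collect_eq poly_endo_mult)

lemma zero_mem_gen_eigenspace: "0 \<in> gen_eigenspace a i"
  by (simp add: gen_eigenspace_def endo_zero[OF endo_poly_endo])

lemma add_mem_gen_eigenspace:
  "u \<in> gen_eigenspace a i \<Longrightarrow> v \<in> gen_eigenspace a i \<Longrightarrow> u + v \<in> gen_eigenspace a i"
  by (simp add: gen_eigenspace_def endo_add[OF endo_poly_endo])

lemma poly_endo_on_gen_eigenspace:
  assumes "[:- a, 1:] ^ i dvd q - [:c:]" "v \<in> gen_eigenspace a i"
  shows "poly_endo q v = c *s v"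
  using poly_endo_dvd_eq_0[OF assms(1)] assms(2)
  by (simp add: gen_eigenspace_def poly_endo_diff endo_zero[OF endo_D])

lemma annihilating_poly_at: "\<exists>p. p \<noteq> 0 \<and> poly_endo p v = 0"
proof (cases "inj_on (\<lambda>i. (D ^^ i) v) {..card Basis}")
  case False
  then obtain i j where "i \<noteq> j" "(D ^^ i) v = (D ^^ j) v" by (auto simp: inj_on_def)
  then have "monom 1 i - monom 1 j \<noteq> (0 :: 'a poly)" "poly_endo (monom 1 i - monom 1 j) v = 0"
    by (simp_all add: monom_eq_iff' poly_endo_diff poly_endo_monom)
  then show ?thesis by blast
next
  case inj: True
  let ?I = "{..card Basis}" and ?d = "\<lambda>i. (D ^^ i) v"
  have "dim (?d ` ?I) < card (?d ` ?I)"
    using dim_subset_UNIV[of "?d ` ?I"] by (simp add: card_image[OF inj] dimension_def)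
  then obtain u j where u: "(\<Sum>x\<in>?d ` ?I. u x *s x) = 0" and j: "j \<in> ?I" "u (?d j) \<noteq> 0"
    using dependent_biggerset_general[of "?d ` ?I"] by (auto simp: dependent_finite)
  define p where "p = (\<Sum>i\<in>?I. monom (u (?d i)) i)"
  have "coeff p j = u (?d j)"
    unfolding p_def using j by (simp add: coeff_sum if_distrib cong: if_cong)
  then have "p \<noteq> 0" using j(2) by auto
  moreover have "poly_endo p v = 0"
    using u by (simp add: p_def poly_endo_sum poly_endo_monom sum.reindex[OF inj])
  ultimately show ?thesis by blast
qed

lemma annihilating_poly: "\<exists>p. p \<noteq> 0 \<and> (\<forall>v. poly_endo p v = 0)"
proof -
  obtain P where P: "\<And>v. P v \<noteq> 0" "\<And>v. poly_endo (P v) v = 0"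
    using annihilating_poly_at by metis
  have "poly_endo (\<Prod>b\<in>Basis. P b) v = 0" for v
  proof (rule endo_eq_0_on_span[OF endo_poly_endo])
    show "v \<in> span Basis" by (simp add: span_Basis)
    show "poly_endo (\<Prod>b\<in>Basis. P b) b = 0" if "b \<in> Basis" for b
      using poly_endo_dvd_eq_0[OF dvd_prodI[OF finite_Basis that] P(2)] .
  qed
  moreover have "(\<Prod>b\<in>Basis. P b) \<noteq> 0" using P(1) finite_Basis by simp
  ultimately show ?thesis by blast
qed

end

section \<open>Simultaneous congruences\<close>

lemma prod_dvd_if_pairwise_coprime:
  fixes m :: "'i \<Rightarrow> 'c::semiring_gcd"
  assumes "finite A" "pairwise (\<lambda>a b. coprime (m a) (m b)) A" "\<And>a. a \<in> A \<Longrightarrow> m a dvd x"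
  shows "(\<Prod>a\<in>A. m a) dvd x"
  using assms
proof (induction A rule: finite_induct)
  case (insert a A)
  have "coprime (m a) (\<Prod>a\<in>A. m a)"
    using insert by (intro prod_coprime_right) (auto simp: pairwise_def)
  then show ?case using insert by (simp add: divides_mult pairwise_insert)
qed simp

lemma chinese_remainder_dvd:
  fixes m u :: "'i \<Rightarrow> 'c::euclidean_ring_gcd"
  assumes "finite A" "pairwise (\<lambda>a b. coprime (m a) (m b)) A"
  shows "\<exists>x. \<forall>a\<in>A. m a dvd x - u a"
  using assms
proof (induction A rule: finite_induct)
  case (insert b A)
  then obtain x where x: "\<And>a. a \<in> A \<Longrightarrow> m a dvd x - u a" by (auto simp: pairwise_insert)
  define P where "P = (\<Prod>a\<in>A. m a)"
  have "coprime P (m b)"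
    unfolding P_def using insert by (intro prod_coprime_left) (auto simp: pairwise_def)
  then obtain s t where bezout: "s * P + t * m b = 1"
    using bezout_coefficients_fst_snd[of P "m b"] by (metis coprime_imp_gcd_eq_1)
  define y where "y = x + P * (s * (u b - x))"
  have "m a dvd y - u a" if "a \<in> A" for a
  proof -
    have "m a dvd P"
      unfolding P_def by (rule dvd_prodI[OF insert.hyps(1) that])
    then have "m a dvd (x - u a) + P * (s * (u b - x))"
      using x[OF that] by (intro dvd_add dvd_mult2)
    then show ?thesis by (simp add: y_def algebra_simps)
  qed
  moreover have "m b dvd y - u b"
  proof -
    have "y - u b = (s * P + t * m b - 1) * (u b - x) + m b * (t * (x - u b))"
      by (simp add: y_def algebra_simps)
    then show ?thesis by (simp add: bezout)
  qed
  ultimately show ?case by auto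
qed simp

lemma coprime_linear_powers:
  fixes a b :: "'a::field_gcd"
  assumes "a \<noteq> b" shows "coprime ([:- a, 1:] ^ i) ([:- b, 1:] ^ j)"
proof -
  have "coprime [:- a, 1:] [:- b, 1:]"
  proof (rule coprimeI)
    fix c assume "c dvd [:- a, 1:]" "c dvd [:- b, 1:]"
    then have "c dvd [:- a, 1:] - [:- b, 1:]" by (rule dvd_diff)
    also have "\<dots> = [:b - a:]" by simp
    also have "\<dots> dvd 1" using assms by (simp add: is_unit_const_poly_iff dvd_field_iff)
    finally show "is_unit c" .
  qed
  then show ?thesis by simp
qed

lemma pairwise_coprime_linear_powers:
  "pairwise (\<lambda>a b :: 'a::field_gcd. coprime ([:- a, 1:] ^ i) ([:- b, 1:] ^ i)) A"
  unfolding pairwise_def using coprime_linear_powers by blast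

lemma poly_interpolation_power:
  fixes u :: "'a::field_gcd \<Rightarrow> 'a"
  assumes "finite A"
  shows "\<exists>q. \<forall>a\<in>A. [:- a, 1:] ^ i dvd q - [:u a:]"
  using chinese_remainder_dvd[OF assms pairwise_coprime_linear_powers, where u = "\<lambda>a. [:u a:]"] .

lemma poly_eq_if_linear_power_dvd:
  fixes p :: "'a::comm_ring_1 poly"
  assumes "[:- a, 1:] ^ i dvd p - [:c:]" "0 < i"
  shows "poly p a = c"
proof -
  have "[:- a, 1:] dvd p - [:c:]"
    using assms by (metis dvd_power dvd_trans)
  then show ?thesis by (simp add: poly_eq_0_iff_dvd[symmetric])
qed

lemma complex_poly_dvd_prod_linear_powers:
  fixes p :: "complex poly"
  assumes "p \<noteq> 0"
  shows "\<exists>A. finite A \<and> p dvd (\<Prod>a\<in>A. [:- a, 1:] ^ Suc (degree p))"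
proof (intro exI conjI)
  let ?A = "{a. poly p a = 0}"
  show "finite ?A" using assms by (rule poly_roots_finite)
  have "smult (lead_coeff p) (\<Prod>a\<in>?A. [:- a, 1:] ^ order a p)
      dvd (\<Prod>a\<in>?A. [:- a, 1:] ^ Suc (degree p))"
    using assms order_degree[OF assms]
    by (intro smult_dvd prod_dvd_prod le_imp_power_dvd) (auto intro: le_SucI)
  then show "p dvd (\<Prod>a\<in>?A. [:- a, 1:] ^ Suc (degree p))"
    by (simp only: complex_poly_decompose)
qed

section \<open>Endomorphisms with split annihilating polynomial\<close>

locale split_endomorphism = endomorphism scale Basis D
  for scale :: "'a::field_gcd \<Rightarrow> 'b::ab_group_add \<Rightarrow> 'b" (infixr \<open>*s\<close> 75) and Basis D +
  fixes \<Lambda> :: "'a set" and N :: nat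
  assumes finite_spectrum: "finite \<Lambda>" and N_pos: "0 < N"
    and annihilated: "poly_endo (\<Prod>a\<in>\<Lambda>. [:- a, 1:] ^ N) v = 0"
begin

lemma poly_endo_eq_0I: "(\<And>a. a \<in> \<Lambda> \<Longrightarrow> [:- a, 1:] ^ N dvd p) \<Longrightarrow> poly_endo p v = 0"
  using poly_endo_dvd_eq_0 annihilated
    prod_dvd_if_pairwise_coprime[OF finite_spectrum pairwise_coprime_linear_powers] by blast

lemma poly_endo_eqI:
  "(\<And>a. a \<in> \<Lambda> \<Longrightarrow> [:- a, 1:] ^ N dvd p - r) \<Longrightarrow> poly_endo p v = poly_endo r v"
  using poly_endo_eq_0I[of "p - r" v] by (simp add: poly_endo_diff)

definition spectral_poly :: "'a \<Rightarrow> 'a poly" where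
  "spectral_poly b = (SOME e. \<forall>a\<in>\<Lambda>. [:- a, 1:] ^ N dvd e - [:of_bool (a = b):])"

abbreviation spectral_proj :: "'a \<Rightarrow> 'b \<Rightarrow> 'b" where
  "spectral_proj b \<equiv> poly_endo (spectral_poly b)"

lemma spectral_poly_cong: "a \<in> \<Lambda> \<Longrightarrow> [:- a, 1:] ^ N dvd spectral_poly b - [:of_bool (a = b):]"
  using someI_ex[OF poly_interpolation_power[OF finite_spectrum, of N "\<lambda>a. of_bool (a = b)"]]
  unfolding spectral_poly_def by blast

lemma spectral_poly_dvd_minus_1: "a \<in> \<Lambda> \<Longrightarrow> [:- a, 1:] ^ N dvd spectral_poly a - 1"
  using spectral_poly_cong[of a a] by (simp add: one_pCons)

lemma spectral_poly_dvd: "a \<in> \<Lambda> \<Longrightarrow> a \<noteq> b \<Longrightarrow> [:- a, 1:] ^ N dvd spectral_poly b"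
  using spectral_poly_cong[of a b] by simp

lemma poly_spectral_poly: "a \<in> \<Lambda> \<Longrightarrow> poly (spectral_poly b) a = of_bool (a = b)"
  using poly_eq_if_linear_power_dvd[OF spectral_poly_cong N_pos] .

lemma sum_spectral_proj: "(\<Sum>b\<in>\<Lambda>. spectral_proj b v) = v"
proof -
  have "poly_endo (\<Sum>b\<in>\<Lambda>. spectral_poly b) v = poly_endo 1 v"
  proof (rule poly_endo_eqI)
    fix a assume a: "a \<in> \<Lambda>"
    have "[:- a, 1:] ^ N dvd (spectral_poly a - 1) + (\<Sum>b\<in>\<Lambda> - {a}. spectral_poly b)"
      using spectral_poly_dvd_minus_1[OF a] spectral_poly_dvd[OF a] by (intro dvd_add dvd_sum) auto
    then show "[:- a, 1:] ^ N dvd (\<Sum>b\<in>\<Lambda>. spectral_poly b) - 1"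
      by (simp add: sum.remove[OF finite_spectrum a] diff_add_eq)
  qed
  then show ?thesis by (simp add: poly_endo_sum)
qed

lemma spectral_proj_in_gen_eigenspace:
  assumes "b \<in> \<Lambda>" shows "spectral_proj b v \<in> gen_eigenspace b N"
proof -
  have "poly_endo ([:- b, 1:] ^ N * spectral_poly b) v = 0"
    using spectral_poly_dvd by (intro poly_endo_eq_0I) (metis dvd_mult dvd_triv_left)
  then show ?thesis by (simp add: gen_eigenspace_def poly_endo_mult)
qed

lemma spectral_proj_idem: "spectral_proj b (spectral_proj b v) = spectral_proj b v"
proof -
  have "poly_endo (spectral_poly b * spectral_poly b) v = spectral_proj b v"
  proof (rule poly_endo_eqI)
    fix a assume "a \<in> \<Lambda>"
    then have "[:- a, 1:] ^ N dvd spectral_poly b * (spectral_poly b - 1)"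
      using spectral_poly_dvd_minus_1[of a] spectral_poly_dvd[of a b]
      by (cases "a = b") (simp_all add: dvd_mult dvd_mult2)
    then show "[:- a, 1:] ^ N dvd spectral_poly b * spectral_poly b - spectral_poly b"
      by (simp add: algebra_simps)
  qed
  then show ?thesis by (simp add: poly_endo_mult)
qed

lemma nilpotent_poly_endo_if_vanishes_on_spectrum:
  assumes "\<And>a. a \<in> \<Lambda> \<Longrightarrow> poly p a = 0"
  shows "nilpotent_map (poly_endo p)"
proof -
  have "poly_endo (p ^ N) v = 0" for v
    using assms by (intro poly_endo_eq_0I dvd_power_same) (simp add: poly_eq_0_iff_dvd)
  then show ?thesis by (auto simp: nilpotent_map_def poly_endo_power)
qed

lemma tr_poly_endo:
  "tr (poly_endo p) = (\<Sum>b\<in>\<Lambda>. poly p b * of_nat (dim (range (spectral_proj b))))"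
proof -
  define r where "r = p - (\<Sum>b\<in>\<Lambda>. smult (poly p b) (spectral_poly b))"
  have "poly r a = 0" if "a \<in> \<Lambda>" for a
    using that finite_spectrum
    by (simp add: r_def poly_sum poly_spectral_poly of_bool_def if_distrib cong: if_cong)
  then have "tr (poly_endo r) = 0"
    by (intro tr_nilpotent endo_poly_endo nilpotent_poly_endo_if_vanishes_on_spectrum)
  moreover have "poly_endo p = (\<lambda>v. (\<Sum>b\<in>\<Lambda>. poly p b *s spectral_proj b v) + poly_endo r v)"
    by (rule ext) (simp add: r_def poly_endo_diff poly_endo_sum poly_endo_smult)
  ultimately show ?thesis
    by (simp add: tr_add tr_sum tr_scale tr_idempotent[OF endo_poly_endo spectral_proj_idem])
qed

lemma nilpotent_map_if_spectral_proj_eq_0: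
  assumes "\<And>b v. b \<in> \<Lambda> \<Longrightarrow> b \<noteq> 0 \<Longrightarrow> spectral_proj b v = 0"
  shows "nilpotent_map D"
proof -
  have "poly_endo (monom 1 N) (spectral_proj b v) = 0" if "b \<in> \<Lambda>" for b v
    using spectral_proj_in_gen_eigenspace[OF that, of v] assms[OF that, of v]
    by (cases "b = 0") (simp_all add: gen_eigenspace_def monom_altdef endo_zero[OF endo_poly_endo])
  then have "poly_endo (monom 1 N) (\<Sum>b\<in>\<Lambda>. spectral_proj b v) = 0" for v
    by (simp add: endo_sum[OF endo_poly_endo])
  then show ?thesis
    by (auto simp: nilpotent_map_def sum_spectral_proj poly_endo_monom)
qed

end

lemma complex_split_endomorphism:
  fixes scale :: "complex \<Rightarrow> 'b::ab_group_add \<Rightarrow> 'b"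
  assumes "endomorphism scale basis D"
  shows "\<exists>\<Lambda> N. split_endomorphism scale basis D \<Lambda> N"
proof -
  interpret endomorphism scale basis D by fact
  obtain p where p: "p \<noteq> 0" "\<And>v. poly_endo p v = 0" using annihilating_poly by blast
  obtain \<Lambda> where \<Lambda>: "finite \<Lambda>" "p dvd (\<Prod>a\<in>\<Lambda>. [:- a, 1:] ^ Suc (degree p))"
    using complex_poly_dvd_prod_linear_powers[OF p(1)] by blast
  have "split_endomorphism scale basis D \<Lambda> (Suc (degree p))"
    by unfold_locales (simp_all only: \<Lambda>(1) zero_less_Suc poly_endo_dvd_eq_0[OF \<Lambda>(2) p(2)])
  then show ?thesis by blast
qed

lemma nilpotent_map_if_tr_conj_eq_0:
  fixes scale :: "complex \<Rightarrow> 'b::ab_group_add \<Rightarrow> 'b"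
  assumes "split_endomorphism scale basis D \<Lambda> N"
    and q: "\<And>a. a \<in> \<Lambda> \<Longrightarrow> poly q a = cnj a"
    and tr0: "fin_dim_space.tr scale basis (\<lambda>v. D (endomorphism.poly_endo scale D q v)) = 0"
  shows "nilpotent_map D"
proof -
  interpret split_endomorphism scale basis D \<Lambda> N by fact
  let ?d = "\<lambda>b. real (dim (range (spectral_proj b)))"
  have "tr (poly_endo ([:0, 1:] * q)) = (\<Sum>b\<in>\<Lambda>. of_real ((cmod b)\<^sup>2 * ?d b))"
    by (simp add: tr_poly_endo q complex_norm_square[symmetric] del: mult_pCons_left)
  moreover have "poly_endo ([:0, 1:] * q) = (\<lambda>v. D (poly_endo q v))"
    by (simp add: fun_eq_iff)
  ultimately have "complex_of_real (\<Sum>b\<in>\<Lambda>. (cmod b)\<^sup>2 * ?d b) = 0"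
    using tr0 by simp
  then have "(\<Sum>b\<in>\<Lambda>. (cmod b)\<^sup>2 * ?d b) = 0" unfolding of_real_eq_0_iff .
  then have "\<forall>b\<in>\<Lambda>. (cmod b)\<^sup>2 * ?d b = 0"
    by (subst (asm) sum_nonneg_eq_0_iff) (auto simp: finite_spectrum)
  then show ?thesis by (intro nilpotent_map_if_spectral_proj_eq_0) auto
qed

section \<open>Derivations and the trace form\<close>

locale bilinear_product = fin_dim_space scale Basis
  for scale :: "'a::field \<Rightarrow> 'b::ab_group_add \<Rightarrow> 'b" (infixr \<open>*s\<close> 75) and Basis +
  fixes B :: "'b \<Rightarrow> 'b \<Rightarrow> 'b"
  assumes endo_left: "endo (\<lambda>u. B u v)" and endo_right: "endo (B u)"
begin

lemmas B_add = endo_add[OF endo_left] endo_add[OF endo_right]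
  and B_scale = endo_scale[OF endo_left] endo_scale[OF endo_right]
  and B_zero = endo_zero[OF endo_left] endo_zero[OF endo_right]
  and B_diff = endo_diff[OF endo_left] endo_diff[OF endo_right]
  and B_sum = endo_sum[OF endo_left] endo_sum[OF endo_right]

end

locale derivation = bilinear_product scale Basis B + endomorphism scale Basis D
  for scale :: "'a::field \<Rightarrow> 'b::ab_group_add \<Rightarrow> 'b" (infixr \<open>*s\<close> 75) and Basis B D +
  assumes derivation: "D (B u v) = B (D u) v + B u (D v)"
begin

lemma product_gen_eigenspaces:
  assumes "u \<in> gen_eigenspace a i" "v \<in> gen_eigenspace b j"
  shows "B u v \<in> gen_eigenspace (a + b) (i + j)"
  using assms
proof (induction "i + j" arbitrary: i j u v rule: less_induct)
  case less
  show ?case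
  proof (cases "i = 0 \<or> j = 0")
    case True
    then have "B u v = 0" using less.prems by (auto simp: gen_eigenspace_0 B_zero)
    then show ?thesis by (simp add: zero_mem_gen_eigenspace)
  next
    case False
    then obtain i' j' where ij: "i = Suc i'" "j = Suc j'" using not0_implies_Suc by blast
    let ?X = "\<lambda>a. poly_endo [:- a, 1:]"
    have "B (?X a u) v \<in> gen_eigenspace (a + b) (i + j')"
      using less.hyps[of i' j "?X a u" v] less.prems unfolding ij mem_gen_eigenspace_Suc by simp
    moreover have "B u (?X b v) \<in> gen_eigenspace (a + b) (i + j')"
      using less.hyps[of i j' u "?X b v"] less.prems unfolding ij(2) mem_gen_eigenspace_Suc by simp
    moreover have "?X (a + b) (B u v) = B (?X a u) v + B u (?X b v)"
      by (simp add: derivation B_add B_scale B_diff scale_left_distrib endo_zero[OF endo_D]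
          algebra_simps)
    ultimately have "?X (a + b) (B u v) \<in> gen_eigenspace (a + b) (i + j')"
      by (simp add: add_mem_gen_eigenspace del: poly_endo_pCons)
    then show ?thesis by (simp add: ij(2) mem_gen_eigenspace_Suc del: poly_endo_pCons)
  qed
qed

end

locale split_derivation = derivation scale Basis B D + split_endomorphism scale Basis D \<Lambda> N
  for scale :: "'a::field_gcd \<Rightarrow> 'b::ab_group_add \<Rightarrow> 'b" (infixr \<open>*s\<close> 75) and Basis B D \<Lambda> N
begin

text \<open>For additive \<open>\<sigma>\<close>, letting \<open>\<sigma> a\<close> act on the generalized eigenspace of \<open>a\<close> is again a
  derivation, because the eigenspaces of \<open>a\<close> and \<open>b\<close> multiply into that of \<open>a + b\<close>.\<close>

lemma additive_function_derivation:
  assumes additive: "\<And>a b. \<sigma> (a + b) = \<sigma> a + \<sigma> b"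
  shows "\<exists>q. (\<forall>a\<in>\<Lambda>. poly q a = \<sigma> a) \<and>
    (\<forall>u v. poly_endo q (B u v) = B (poly_endo q u) v + B u (poly_endo q v))"
proof -
  let ?\<Lambda>' = "\<Lambda> \<union> (\<lambda>(a, b). a + b) ` (\<Lambda> \<times> \<Lambda>)"
  obtain q where q: "\<And>a. a \<in> ?\<Lambda>' \<Longrightarrow> [:- a, 1:] ^ (N + N) dvd q - [:\<sigma> a:]"
    using poly_interpolation_power[of ?\<Lambda>' "N + N" \<sigma>] finite_spectrum by auto
  have eigen: "poly_endo q u = \<sigma> a *s u" if "a \<in> \<Lambda>" "u \<in> gen_eigenspace a N" for a u
    by (rule poly_endo_on_gen_eigenspace[OF power_le_dvd[OF q] that(2)]) (simp_all add: that(1))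
  have homogeneous: "poly_endo q (B u v) = B (poly_endo q u) v + B u (poly_endo q v)"
    if ab: "a \<in> \<Lambda>" "b \<in> \<Lambda>"
      and uv: "u \<in> gen_eigenspace a N" "v \<in> gen_eigenspace b N" for a b u v
  proof -
    have "poly_endo q (B u v) = \<sigma> (a + b) *s B u v"
      using ab by (intro poly_endo_on_gen_eigenspace[OF q product_gen_eigenspaces[OF uv]]) auto
    then show ?thesis
      by (simp add: eigen[OF ab(1) uv(1)] eigen[OF ab(2) uv(2)] additive B_scale scale_left_distrib)
  qed
  have "poly_endo q (B u v) = B (poly_endo q u) v + B u (poly_endo q v)" for u v
  proof -
    let ?u = "\<lambda>a. spectral_proj a u" and ?v = "\<lambda>b. spectral_proj b v"
    have "poly_endo q (B (\<Sum>a\<in>\<Lambda>. ?u a) (\<Sum>b\<in>\<Lambda>. ?v b))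
        = (\<Sum>b\<in>\<Lambda>. \<Sum>a\<in>\<Lambda>. poly_endo q (B (?u a) (?v b)))"
      by (simp add: B_sum endo_sum[OF endo_poly_endo])
    also have "\<dots> = (\<Sum>b\<in>\<Lambda>. \<Sum>a\<in>\<Lambda>. B (poly_endo q (?u a)) (?v b) + B (?u a) (poly_endo q (?v b)))"
      using homogeneous spectral_proj_in_gen_eigenspace by (intro sum.cong) auto
    also have "\<dots> = B (poly_endo q (\<Sum>a\<in>\<Lambda>. ?u a)) (\<Sum>b\<in>\<Lambda>. ?v b)
        + B (\<Sum>a\<in>\<Lambda>. ?u a) (poly_endo q (\<Sum>b\<in>\<Lambda>. ?v b))"
      by (simp add: B_sum endo_sum[OF endo_poly_endo] sum.distrib)
    finally show ?thesis by (simp only: sum_spectral_proj)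
  qed
  moreover have "poly q a = \<sigma> a" if "a \<in> \<Lambda>" for a
    using poly_eq_if_linear_power_dvd[OF q] that N_pos by blast
  ultimately show ?thesis by blast
qed

end

locale leibniz_algebra = bilinear_product scale Basis B
  for scale :: "'a::field \<Rightarrow> 'b::ab_group_add \<Rightarrow> 'b" (infixr \<open>*s\<close> 75) and Basis B +
  assumes leibniz: "B x (B u v) = B (B x u) v + B u (B x v)"
begin

lemma derivation_left_mult: "derivation scale Basis B (B x)"
  by unfold_locales (rule B_add(2) B_scale(2) leibniz)+

definition trace_form :: "'b \<Rightarrow> 'b \<Rightarrow> 'a" where
  "trace_form u v = tr (\<lambda>w. B u (B v w))"

lemma tr_product_derivation:
  assumes Q: "endo Q" and derivation: "\<And>u v. Q (B u v) = B (Q u) v + B u (Q v)"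
  shows "tr (\<lambda>w. B (B a b) (Q w)) = - trace_form a (Q b)"
proof -
  have "B (B a b) (Q w) = B a (B b (Q w)) - B b (B a (Q w))" for w
    using leibniz[of a b "Q w"] by simp
  then have "tr (\<lambda>w. B (B a b) (Q w)) = tr (\<lambda>w. B a (B b (Q w))) - tr (\<lambda>w. B b (B a (Q w)))"
    by (simp add: tr_diff)
  also have "tr (\<lambda>w. B b (B a (Q w))) = tr (\<lambda>w. B a (Q (B b w)))"
    by (rule tr_commute[OF endo_right[of b] endo_compose[OF endo_right[of a] Q]])
  also have "tr (\<lambda>w. B a (B b (Q w))) - \<dots> = - trace_form a (Q b)"
    by (simp add: trace_form_def derivation B_add tr_add)
  finally show ?thesis .
qed

lemma trace_form_product: "trace_form (B a b) c = - trace_form a (B c b)"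
  unfolding trace_form_def[of "B a b"] by (rule tr_product_derivation[OF endo_right leibniz])

end

lemma cartan_nilpotency:
  fixes scale :: "complex \<Rightarrow> 'b::ab_group_add \<Rightarrow> 'b"
  assumes "leibniz_algebra scale basis B"
    and S: "module.subspace scale S" "\<And>u v. u \<in> S \<Longrightarrow> v \<in> S \<Longrightarrow> B u v \<in> S"
    and isotropic: "\<And>u v. u \<in> S \<Longrightarrow> v \<in> S \<Longrightarrow> leibniz_algebra.trace_form scale basis B u v = 0"
    and x: "x \<in> module.span scale {B u v | u v. u \<in> S \<and> v \<in> S}"
  shows "nilpotent_map (B x)"
proof -
  interpret leibniz_algebra scale basis B by fact
  interpret derivation scale basis B "B x" by (rule derivation_left_mult)
  obtain \<Lambda> N where split: "split_endomorphism scale basis (B x) \<Lambda> N"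
    using complex_split_endomorphism[OF endomorphism_axioms] by blast
  interpret split_endomorphism scale basis "B x" \<Lambda> N by fact
  interpret split_derivation scale basis B "B x" \<Lambda> N by unfold_locales
  obtain q where q: "\<And>a. a \<in> \<Lambda> \<Longrightarrow> poly q a = cnj a"
    and derivation_q: "\<And>u v. poly_endo q (B u v) = B (poly_endo q u) v + B u (poly_endo q v)"
    using additive_function_derivation[of cnj, OF complex_cnj_add] by blast
  have "{B u v | u v. u \<in> S \<and> v \<in> S} \<subseteq> S" using S(2) by auto
  then have "x \<in> S" using x span_minimal[OF _ S(1)] by blast
  then have q_S: "poly_endo q b \<in> S" if "b \<in> S" for b
    using poly_endo_in_subspace[OF S(1)] S(2) that by blast
  have "tr (\<lambda>w. B y (poly_endo q w)) = 0" if "y \<in> span {B u v | u v. u \<in> S \<and> v \<in> S}" for y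
    using that
  proof (induction rule: span_induct_alt)
    case base
    then show ?case by (simp add: B_zero tr_zero)
  next
    case (step c y z)
    then obtain a b where "y = B a b" "a \<in> S" "b \<in> S" by auto
    then have "tr (\<lambda>w. B y (poly_endo q w)) = 0"
      using tr_product_derivation[OF endo_poly_endo derivation_q] isotropic q_S by simp
    then show ?case using step.IH by (simp add: B_add B_scale tr_add tr_scale)
  qed
  then show ?thesis using nilpotent_map_if_tr_conj_eq_0[OF split q] x by blast
qed

section \<open>Complexification\<close>

text \<open>The pair \<open>(x, y)\<close> stands for \<open>x + \<i> y\<close>.\<close>

definition cscale :: "complex \<Rightarrow> 'a::real_vector \<times> 'a \<Rightarrow> 'a \<times> 'a" where
  "cscale c z = (Re c *\<^sub>R fst z - Im c *\<^sub>R snd z, Re c *\<^sub>R snd z + Im c *\<^sub>R fst z)"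

definition cBasis :: "('a::euclidean_space \<times> 'a) set" where
  "cBasis = (\<lambda>b. (b, 0)) ` Basis"

definition cproduct :: "('a::real_vector \<Rightarrow> 'a \<Rightarrow> 'a) \<Rightarrow> 'a \<times> 'a \<Rightarrow> 'a \<times> 'a \<Rightarrow> 'a \<times> 'a" where
  "cproduct B z w = (B (fst z) (fst w) - B (snd z) (snd w), B (fst z) (snd w) + B (snd z) (fst w))"

interpretation complexified: vector_space "cscale :: complex \<Rightarrow> 'a::real_vector \<times> 'a \<Rightarrow> 'a \<times> 'a"
  by unfold_locales (simp_all add: cscale_def prod_eq_iff algebra_simps)

lemma sum_cBasis: "(\<Sum>z\<in>cBasis. f z) = (\<Sum>b\<in>Basis. f (b, 0))"
  unfolding cBasis_def by (subst sum.reindex) (auto simp: inj_on_def)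

lemma cBasis_expansion: "(\<Sum>z\<in>cBasis. cscale (Complex (fst v \<bullet> fst z) (snd v \<bullet> fst z)) z) = v"
  by (simp add: sum_cBasis cscale_def prod_eq_iff fst_sum snd_sum euclidean_representation)

interpretation complexified: fin_dim_space
  "cscale :: complex \<Rightarrow> 'a::euclidean_space \<times> 'a \<Rightarrow> 'a \<times> 'a" cBasis
proof unfold_locales
  show fin: "finite (cBasis :: ('a \<times> 'a) set)" by (simp add: cBasis_def)
  show "complexified.independent (cBasis :: ('a \<times> 'a) set)"
    unfolding complexified.dependent_finite[OF fin]
  proof safe
    fix u :: "'a \<times> 'a \<Rightarrow> complex" and x y :: 'a
    assume combination: "(\<Sum>v\<in>cBasis. cscale (u v) v) = 0" and xy: "(x, y) \<in> cBasis" "u (x, y) \<noteq> 0"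
    have x: "x \<in> Basis" "y = 0" using xy by (auto simp: cBasis_def)
    have "(\<Sum>b\<in>Basis. Re (u (b, 0)) *\<^sub>R b) = 0" "(\<Sum>b\<in>Basis. Im (u (b, 0)) *\<^sub>R b) = 0"
      using combination by (simp_all add: sum_cBasis cscale_def prod_eq_iff fst_sum snd_sum)
    then have "Re (u (x, 0)) = 0" "Im (u (x, 0)) = 0"
      using inner_sum_left_Basis[OF x(1), of "\<lambda>b. Re (u (b, 0))"]
        inner_sum_left_Basis[OF x(1), of "\<lambda>b. Im (u (b, 0))"] by simp_all
    then show False using xy x by (simp add: complex_eq_iff)
  qed
  show "complexified.span cBasis = (UNIV :: ('a \<times> 'a) set)"
  proof (intro equalityI subsetI UNIV_I)
    fix v :: "'a \<times> 'a"
    have "(\<Sum>z\<in>cBasis. cscale (Complex (fst v \<bullet> fst z) (snd v \<bullet> fst z)) z)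
        \<in> complexified.span cBasis"
      by (intro complexified.span_sum complexified.span_scale complexified.span_base)
    then show "v \<in> complexified.span cBasis" by (simp only: cBasis_expansion)
  qed
qed

interpretation real_space: fin_dim_space
  "scaleR :: real \<Rightarrow> 'a::euclidean_space \<Rightarrow> 'a" Basis
  by (intro fin_dim_space.intro finite_dimensional_vector_space_euclidean)

lemma real_space_tr: "real_space.tr f = (\<Sum>b\<in>Basis. f b \<bullet> b)"
  unfolding real_space.trace_on_def
  by (intro sum.cong real_space.representation_Basis_eqI euclidean_representation) simp_all

lemma complexified_tr:
  fixes F :: "'a::euclidean_space \<times> 'a \<Rightarrow> 'a \<times> 'a"
  shows "complexified.tr F
    = Complex (real_space.tr (\<lambda>b. fst (F (b, 0)))) (real_space.tr (\<lambda>b. snd (F (b, 0))))"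
proof -
  have "complexified.tr F = (\<Sum>z\<in>cBasis. Complex (fst (F z) \<bullet> fst z) (snd (F z) \<bullet> fst z))"
    unfolding complexified.trace_on_def
    by (intro sum.cong complexified.representation_Basis_eqI cBasis_expansion) simp_all
  then show ?thesis by (simp add: sum_cBasis real_space_tr complex_eq_iff)
qed

locale real_leibniz_algebra = real: leibniz_algebra scaleR Basis B
  for B :: "'a::euclidean_space \<Rightarrow> 'a \<Rightarrow> 'a"
begin

sublocale complexified: leibniz_algebra cscale cBasis "cproduct B"
proof unfold_locales
  show "cproduct B x (cproduct B u v)
      = cproduct B (cproduct B x u) v + cproduct B u (cproduct B x v)" for x u v
    unfolding cproduct_def prod_eq_iff
    by (simp add: real.B_add real.B_diff real.leibniz[of "fst x"] real.leibniz[of "snd x"])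
qed (simp_all add: cproduct_def cscale_def prod_eq_iff real.B_add real.B_diff real.B_scale
    algebra_simps)

lemma complexified_trace_form:
  "complexified.trace_form u v = Complex
    (real.trace_form (fst u) (fst v) - real.trace_form (snd u) (snd v))
    (real.trace_form (fst u) (snd v) + real.trace_form (snd u) (fst v))"
  unfolding complexified.trace_form_def complexified_tr real.trace_form_def
  by (simp add: cproduct_def real.B_zero real.tr_add real.tr_diff)

lemma of_real_mem_complexified_span:
  assumes "x \<in> span {B u v | u v. u \<in> S \<and> v \<in> S}" "0 \<in> S"
  shows "(x, 0) \<in> complexified.span {cproduct B u v | u v. u \<in> S \<times> S \<and> v \<in> S \<times> S}"
    (is "_ \<in> complexified.span ?G")
  using assms(1)
proof (induction rule: span_induct_alt)
  case base
  then show ?case using complexified.span_zero by (simp add: zero_prod_def)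
next
  case (step c y z)
  then obtain u v where "y = B u v" "u \<in> S" "v \<in> S" by auto
  then have "(y, 0) = cproduct B (u, 0) (v, 0)" "(u, 0) \<in> S \<times> S" "(v, 0) \<in> S \<times> S"
    using assms(2) by (simp_all add: cproduct_def real.B_zero)
  then have "(y, 0) \<in> ?G" by blast
  then have "cscale (complex_of_real c) (y, 0) + (z, 0) \<in> complexified.span ?G"
    by (rule complexified.span_add[OF complexified.span_scale[OF complexified.span_base] step.IH])
  moreover have "cscale (complex_of_real c) (y, 0) + (z, 0) = (c *\<^sub>R y + z, 0)"
    by (simp add: cscale_def)
  ultimately show ?case by (simp only:)
qed

lemma real_cartan_nilpotency:
  assumes S: "subspace S" "\<And>u v. u \<in> S \<Longrightarrow> v \<in> S \<Longrightarrow> B u v \<in> S"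
    and isotropic: "\<And>u v. u \<in> S \<Longrightarrow> v \<in> S \<Longrightarrow> real.trace_form u v = 0"
    and x: "x \<in> span {B u v | u v. u \<in> S \<and> v \<in> S}"
  shows "nilpotent_map (B x)"
proof -
  have "nilpotent_map (cproduct B (x, 0))"
  proof (rule cartan_nilpotency[OF complexified.leibniz_algebra_axioms, of "S \<times> S"])
    show "complexified.subspace (S \<times> S)"
      unfolding complexified.subspace_def using S(1)
      by (auto simp: cscale_def subspace_0 subspace_add subspace_diff subspace_scale zero_prod_def)
    show "cproduct B u v \<in> S \<times> S" if "u \<in> S \<times> S" "v \<in> S \<times> S" for u v
      using that S by (auto simp: cproduct_def subspace_add subspace_diff)
    show "complexified.trace_form u v = 0" if "u \<in> S \<times> S" "v \<in> S \<times> S" for u v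
      using that isotropic by (auto simp: complexified_trace_form complex_eq_iff)
  qed (rule of_real_mem_complexified_span[OF x subspace_0[OF S(1)]])
  moreover have "(cproduct B (x, 0) ^^ i) (v, 0) = ((B x ^^ i) v, 0)" for i v
    by (induction i) (simp_all add: cproduct_def real.B_zero)
  ultimately show ?thesis
    unfolding nilpotent_map_def by (metis fst_conv fst_zero)
qed

end

section \<open>Nondegenerate subspaces and orthogonal projections\<close>

lemma functionals_eq_on_span:
  fixes \<phi> \<psi> :: "'a::real_vector \<Rightarrow> real"
  assumes A: "finite A" "independent A" and "linear \<phi>" "linear \<psi>"
    and eq: "(\<Sum>a\<in>A. \<phi> a *\<^sub>R a) = (\<Sum>a\<in>A. \<psi> a *\<^sub>R a)" and "x \<in> span A"
  shows "\<phi> x = \<psi> x"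
proof (rule linear_eq_on_span[OF assms(3,4) _ assms(6)])
  have "(\<Sum>a\<in>A. (\<phi> a - \<psi> a) *\<^sub>R a) = 0"
    using eq by (simp add: scaleR_diff_left sum_subtractf)
  then show "\<phi> a = \<psi> a" if "a \<in> A" for a
    using independentD[OF A(2,1) order_refl _ that] by fastforce
qed

locale nondegenerate_subspace =
  fixes g :: "'a::euclidean_space \<Rightarrow> 'a \<Rightarrow> real" and S :: "'a set"
  assumes bilinear: "bilinear g" and subspace: "subspace S"
    and nondegenerate: "x \<in> S \<Longrightarrow> (\<And>y. y \<in> S \<Longrightarrow> g x y = 0) \<Longrightarrow> x = 0"
begin

lemma linear_left: "linear (\<lambda>x. g x y)" and linear_right: "linear (g x)"
  using bilinear by (auto simp: bilinear_def)

lemmas form_simps =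
  linear_0[OF linear_left] linear_0[OF linear_right]
  linear_add[OF linear_left] linear_add[OF linear_right]
  linear_neg[OF linear_left] linear_neg[OF linear_right]
  linear_diff[OF linear_left] linear_diff[OF linear_right]
  linear_scale[OF linear_left] linear_scale[OF linear_right]
  linear_sum[OF linear_left] linear_sum[OF linear_right]

lemma represents_functional:
  assumes \<phi>: "linear \<phi>"
  shows "\<exists>z\<in>S. \<forall>y\<in>S. g z y = \<phi> y"
proof -
  obtain A where A: "finite A" "A \<subseteq> S" "independent A" "span A = S"
    using basis_subspace_exists[OF subspace] by metis
  define T where "T x = (\<Sum>a\<in>A. g x a *\<^sub>R a)" for x
  have linear_T: "linear T"
    unfolding T_def
    by (rule linearI) (simp_all add: form_simps scaleR_add_left sum.distrib scaleR_sum_right)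
  have combination_S: "(\<Sum>a\<in>A. f a *\<^sub>R a) \<in> S" for f
    using A(2) subspace by (intro subspace_sum subspace_scale) auto
  have "x = 0" if "x \<in> S" "T x = 0" for x
    using functionals_eq_on_span[OF A(1,3) linear_right linear_zero] A(4) that
    by (intro nondegenerate) (auto simp: T_def)
  then have "inj_on T S" using linear_inj_on_iff_eq_0[OF linear_T subspace] by blast
  then have "dim (T ` S) = dim S"
    using dim_image_eq[OF linear_T] subspace by (metis span_eq_iff)
  moreover have "T ` S \<subseteq> S" using combination_S by (auto simp: T_def)
  ultimately have "T ` S = S"
    using linear_subspace_image[OF linear_T subspace] subspace by (intro subspace_dim_equal) auto
  then obtain z where "z \<in> S" "T z = (\<Sum>a\<in>A. \<phi> a *\<^sub>R a)"
    using combination_S[of \<phi>] by (metis imageE)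
  then show ?thesis
    using functionals_eq_on_span[OF A(1,3) linear_right \<phi>] A(4) unfolding T_def by blast
qed

lemma orth_proj_eqI:
  assumes y: "y \<in> S" "\<And>z. z \<in> S \<Longrightarrow> g y z = g x z"
  shows "orth_proj g S x = y"
  unfolding orth_proj_def
proof (rule the_equality)
  show "y \<in> S \<and> (\<forall>z\<in>S. g (x - y) z = 0)"
    using y by (simp add: form_simps)
  fix y' assume y': "y' \<in> S \<and> (\<forall>z\<in>S. g (x - y') z = 0)"
  have "y' - y = 0"
    using y y' by (intro nondegenerate subspace_diff[OF subspace]) (auto simp: form_simps)
  then show "y' = y" by simp
qed

lemma orth_proj_mem: "orth_proj g S x \<in> S"
  and orth_proj_inner: "z \<in> S \<Longrightarrow> g (orth_proj g S x) z = g x z"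
proof -
  obtain y where "y \<in> S" "\<And>z. z \<in> S \<Longrightarrow> g y z = g x z"
    using represents_functional[OF linear_right[of x]] by blast
  then show "orth_proj g S x \<in> S" "z \<in> S \<Longrightarrow> g (orth_proj g S x) z = g x z"
    by (simp_all add: orth_proj_eqI)
qed

lemma orth_proj_eq_0_iff: "orth_proj g S x = 0 \<longleftrightarrow> (\<forall>z\<in>S. g x z = 0)"
  using orth_proj_eqI[of 0 x] orth_proj_inner[of _ x] subspace_0[OF subspace]
  by (auto simp: form_simps)

lemma linear_orth_proj: "linear (orth_proj g S)"
proof (rule linearI)
  show "orth_proj g S (x + y) = orth_proj g S x + orth_proj g S y" for x y
    by (rule orth_proj_eqI)
      (simp_all add: orth_proj_mem orth_proj_inner subspace_add[OF subspace] form_simps)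
  show "orth_proj g S (c *\<^sub>R x) = c *\<^sub>R orth_proj g S x" for c x
    by (rule orth_proj_eqI)
      (simp_all add: orth_proj_mem orth_proj_inner subspace_scale[OF subspace] form_simps)
qed

end

lemma nondegenerate_subspace_UNIV:
  "semi_riem_metric g \<Longrightarrow> nondegenerate_subspace g (UNIV :: 'a::euclidean_space set)"
  by unfold_locales (auto simp: semi_riem_metric_def)

lemma nondegenerate_subspace_if_splits:
  fixes g :: "'a::euclidean_space \<Rightarrow> 'a \<Rightarrow> real"
  assumes g: "semi_riem_metric g" and S: "subspace S"
    and splits: "\<And>z. \<exists>x\<in>S. \<forall>u\<in>S. g u (z - x) = 0"
  shows "nondegenerate_subspace g S"
proof
  interpret nondegenerate_subspace g UNIV using g by (rule nondegenerate_subspace_UNIV)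
  fix x assume x: "x \<in> S" "\<And>y. y \<in> S \<Longrightarrow> g x y = 0"
  have "g x z = 0" for z
  proof -
    obtain y where "y \<in> S" "g x (z - y) = 0" using splits[of z] x(1) by blast
    then show ?thesis using x(2)[of y] by (simp add: form_simps)
  qed
  then show "x = 0" by (rule nondegenerate[OF UNIV_I])
qed (use g S in \<open>simp_all add: semi_riem_metric_def\<close>)

section \<open>Engel's theorem and Cartan's criterion\<close>

lemma mem_span_insert_subspace:
  "subspace N \<Longrightarrow> u \<in> span (insert z N) \<longleftrightarrow> (\<exists>t. u - t *\<^sub>R z \<in> N)"
  using span_breakdown_eq[of u z N] by (simp add: span_eq_iff[THEN iffD2])

lemma subspace_dim_less:
  fixes S T :: "'a::euclidean_space set"
  shows "subspace S \<Longrightarrow> subspace T \<Longrightarrow> S \<subset> T \<Longrightarrow> dim S < dim T"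
  by (metis dim_psubset span_eq_iff)

lemma last_iterate_outside:
  assumes "w \<notin> U" "(f ^^ n) w \<in> U"
  shows "\<exists>j. (f ^^ j) w \<notin> U \<and> f ((f ^^ j) w) \<in> U"
  using assms(2)
proof (induction n)
  case (Suc n)
  then show ?case by (cases "(f ^^ n) w \<in> U") auto
qed (use assms(1) in simp)

locale real_lie_algebra =
  fixes br :: "'a::euclidean_space \<Rightarrow> 'a \<Rightarrow> 'a"
  assumes lie: "lie_algebra br"
begin

lemma br_self [simp]: "br x x = 0"
  using lie by (simp add: lie_algebra_def)

lemma linear_ad: "linear (br x)" and linear_br_left: "linear (\<lambda>x. br x y)"
  using lie by (auto simp: lie_algebra_def bilinear_def)

lemma br_anti: "br x y = - br y x"
proof -
  have "br (x + y) (x + y) = 0" by (rule br_self)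
  then have "br x y + br y x = 0"
    unfolding linear_add[OF linear_ad] linear_add[OF linear_br_left] by (simp add: add.commute)
  then show ?thesis by (simp add: eq_neg_iff_add_eq_0)
qed

sublocale adjoint: real_leibniz_algebra br
proof unfold_locales
  fix x y z
  have "br x (br y z) + br y (br z x) + br z (br x y) = 0"
    using lie unfolding lie_algebra_def by blast
  moreover have "br y (br z x) = - br y (br x z)"
    using br_anti[of z x] linear_neg[OF linear_ad] by simp
  moreover have "br z (br x y) = - br (br x y) z" by (rule br_anti)
  ultimately show "br x (br y z) = br (br x y) z + br y (br x z)" by (simp add: algebra_simps)
qed (simp_all add: linear_add[OF linear_ad] linear_add[OF linear_br_left]
    linear_scale[OF linear_ad] linear_scale[OF linear_br_left])

lemmas br_add = adjoint.real.B_add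
  and br_diff = adjoint.real.B_diff
  and br_scale = adjoint.real.B_scale
  and br_zero = adjoint.real.B_zero
  and br_sum = adjoint.real.B_sum
  and br_leibniz = adjoint.real.leibniz

abbreviation trace_form :: "'a \<Rightarrow> 'a \<Rightarrow> real" where
  "trace_form \<equiv> adjoint.real.trace_form"

abbreviation derived :: "'a set \<Rightarrow> 'a set" where
  "derived S \<equiv> span {br x y | x y. x \<in> S \<and> y \<in> S}"

definition transporter :: "'a set \<Rightarrow> 'a set \<Rightarrow> 'a set" where
  "transporter L U = {v. \<forall>x\<in>L. br x v \<in> U}"

lemma transporter_antimono: "N \<subseteq> L \<Longrightarrow> transporter L U \<subseteq> transporter N U"
  by (auto simp: transporter_def)

lemma subalgebra_subset_transporter: "lie_subalgebra br L \<Longrightarrow> N \<subseteq> L \<Longrightarrow> L \<subseteq> transporter N L"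
  by (auto simp: lie_subalgebra_def transporter_def)

lemma lie_subalgebra_derived:
  assumes "lie_subalgebra br S"
  shows "derived S \<subseteq> S" "lie_subalgebra br (derived S)"
proof -
  show sub: "derived S \<subseteq> S"
    using assms by (intro span_minimal) (auto simp: lie_subalgebra_def)
  then show "lie_subalgebra br (derived S)"
    unfolding lie_subalgebra_def by (auto intro!: span_base)
qed

lemma br_span_insert_normalizing:
  assumes N: "lie_subalgebra br N" and z: "z \<in> transporter N N"
    and uv: "u \<in> span (insert z N)" "v \<in> span (insert z N)"
  shows "br u v \<in> N"
proof -
  have sub: "subspace N" using N by (simp add: lie_subalgebra_def)
  obtain s t where st: "u - s *\<^sub>R z \<in> N" "v - t *\<^sub>R z \<in> N"
    using uv by (auto simp: mem_span_insert_subspace[OF sub])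
  then have "br (u - s *\<^sub>R z) (v - t *\<^sub>R z) + t *\<^sub>R br (u - s *\<^sub>R z) z - s *\<^sub>R br (v - t *\<^sub>R z) z \<in> N"
    using N z
    by (intro subspace_add[OF sub] subspace_diff[OF sub] subspace_scale[OF sub])
      (auto simp: lie_subalgebra_def transporter_def)
  moreover have "br u v
      = br (u - s *\<^sub>R z) (v - t *\<^sub>R z) + t *\<^sub>R br (u - s *\<^sub>R z) z - s *\<^sub>R br (v - t *\<^sub>R z) z"
    using br_anti[of z v] by (simp add: br_diff br_scale algebra_simps)
  ultimately show ?thesis by simp
qed

lemma lie_subalgebra_span_insert_normalizing:
  assumes "lie_subalgebra br N" "z \<in> transporter N N"
  shows "lie_subalgebra br (span (insert z N))"
  using br_span_insert_normalizing[OF assms] by (auto simp: lie_subalgebra_def intro: span_base)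

lemma codim_one_subalgebra:
  assumes L: "lie_subalgebra br L" "L \<noteq> {0}"
    and normalizer_grows: "\<And>N. lie_subalgebra br N \<Longrightarrow> N \<subset> L \<Longrightarrow> \<exists>z\<in>L - N. z \<in> transporter N N"
  shows "\<exists>N z. lie_subalgebra br N \<and> N \<subset> L \<and> z \<in> transporter N N \<and> L = span (insert z N)"
proof -
  let ?P = "\<lambda>N. lie_subalgebra br N \<and> N \<subset> L"
  have subL: "subspace L" using L by (simp add: lie_subalgebra_def)
  have "?P {0}" using L subspace_0[OF subL] by (auto simp: lie_subalgebra_def)
  moreover have "\<forall>N. ?P N \<longrightarrow> dim N < Suc (dim L)"
    using dim_subset by (auto simp: less_Suc_eq_le)
  ultimately obtain N where N: "?P N" and maximal: "\<And>N'. ?P N' \<Longrightarrow> dim N' \<le> dim N"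
    using ex_has_greatest_nat[of ?P "{0}" dim "Suc (dim L)"] by blast
  obtain z where z: "z \<in> L" "z \<notin> N" "z \<in> transporter N N" using normalizer_grows[of N] N by blast
  let ?N' = "span (insert z N)"
  have subalgebra: "lie_subalgebra br ?N'"
    using lie_subalgebra_span_insert_normalizing N z(3) by blast
  have "N \<subset> ?N'" using z(2) span_superset[of "insert z N"] by blast
  then have "dim N < dim ?N'"
    using N by (intro subspace_dim_less) (auto simp: lie_subalgebra_def)
  moreover have "?N' \<subseteq> L" using N z(1) subL by (intro span_minimal) auto
  ultimately have "L = ?N'" using maximal[of ?N'] subalgebra by force
  then show ?thesis using N z(3) by blast
qed

lemma transporter_extend:
  assumes U: "subspace U" and N: "subspace N" and z: "z \<in> transporter N N" "nilpotent_map (br z)"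
    and inv: "\<And>u. u \<in> U \<Longrightarrow> br z u \<in> U" "\<And>u. u \<in> W \<Longrightarrow> br z u \<in> W" "U \<subseteq> transporter N U"
    and w: "w \<in> W - U" "w \<in> transporter N U"
  shows "\<exists>v\<in>W - U. v \<in> transporter (span (insert z N)) U"
proof -
  let ?w = "\<lambda>i. (br z ^^ i) w"
  have iterate: "?w i \<in> W \<and> ?w i \<in> transporter N U" for i
  proof (induction i)
    case (Suc i)
    have "br x (br z (?w i)) \<in> U" if "x \<in> N" for x
      unfolding br_leibniz[of x z]
      using Suc z(1) inv(1) that by (intro subspace_add[OF U]) (auto simp: transporter_def)
    then show ?case using Suc inv(2) by (simp add: transporter_def)
  qed (use w in simp)
  obtain n where "?w n = 0" using z(2) by (auto simp: nilpotent_map_def)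
  then obtain j where j: "?w j \<notin> U" "br z (?w j) \<in> U"
    using last_iterate_outside[of w U n "br z"] w(1) subspace_0[OF U] by auto
  have "br x (?w j) \<in> U" if x: "x \<in> span (insert z N)" for x
  proof -
    obtain t where "x - t *\<^sub>R z \<in> N" using x mem_span_insert_subspace[OF N] by blast
    then have "br (x - t *\<^sub>R z) (?w j) \<in> U" using iterate by (simp add: transporter_def)
    then have "br (x - t *\<^sub>R z) (?w j) + t *\<^sub>R br z (?w j) \<in> U"
      using j(2) by (intro subspace_add[OF U] subspace_scale[OF U])
    then show ?thesis by (simp add: br_diff br_scale)
  qed
  then show ?thesis using iterate j(1) by (auto simp: transporter_def)
qed

lemma engel:
  assumes "lie_subalgebra br L" "\<And>x. x \<in> L \<Longrightarrow> nilpotent_map (br x)"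
    and "subspace U" "U \<subset> W" "U \<subseteq> transporter L U" "W \<subseteq> transporter L W"
  shows "\<exists>v\<in>W - U. v \<in> transporter L U"
  using assms
proof (induction "dim L" arbitrary: L U W rule: less_induct)
  case less
  show ?case
  proof (cases "L = {0}")
    case True
    then show ?thesis
      using less.prems(3,4) by (auto simp: transporter_def br_zero subspace_0)
  next
    case False
    have smaller: "\<exists>v\<in>W' - U'. v \<in> transporter N U'"
      if "lie_subalgebra br N" "N \<subset> L" "subspace U'" "U' \<subset> W'"
        "U' \<subseteq> transporter N U'" "W' \<subseteq> transporter N W'" for N U' W'
    proof (rule less.hyps[OF _ that(1) _ that(3-6)])
      show "dim N < dim L"
        using that less.prems(1) by (intro subspace_dim_less) (auto simp: lie_subalgebra_def)
    qed (use less.prems(2) that(2) in blast)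
    have "\<exists>z\<in>L - N. z \<in> transporter N N" if "lie_subalgebra br N" "N \<subset> L" for N
      using that less.prems(1) subalgebra_subset_transporter
      by (intro smaller) (auto simp: lie_subalgebra_def)
    then obtain N z where N: "lie_subalgebra br N" "N \<subset> L" "z \<in> transporter N N"
      and L: "L = span (insert z N)"
      using codim_one_subalgebra[OF less.prems(1) False] by blast
    have "U \<subseteq> transporter N U" "W \<subseteq> transporter N W"
      using less.prems(5,6) transporter_antimono N(2) by blast+
    then obtain w where "w \<in> W - U" "w \<in> transporter N U"
      using smaller[OF N(1,2) less.prems(3,4)] by blast
    moreover have "z \<in> L" unfolding L by (simp add: span_base)
    then have "nilpotent_map (br z)" "\<And>u. u \<in> U \<Longrightarrow> br z u \<in> U" "\<And>u. u \<in> W \<Longrightarrow> br z u \<in> W"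
      using less.prems(2,5,6) by (auto simp: transporter_def)
    moreover have "subspace N" using N(1) by (simp add: lie_subalgebra_def)
    ultimately show ?thesis
      unfolding L using less.prems(3) N(3) \<open>U \<subseteq> transporter N U\<close> by (intro transporter_extend)
  qed
qed

lemma derived_psubset_if_ad_nilpotent:
  assumes L: "lie_subalgebra br L" "\<And>x. x \<in> L \<Longrightarrow> nilpotent_map (br x)" "L \<noteq> {0}"
  shows "derived L \<subset> L"
proof -
  have "\<exists>z\<in>L - N. z \<in> transporter N N" if "lie_subalgebra br N" "N \<subset> L" for N
    using that L subalgebra_subset_transporter by (intro engel) (auto simp: lie_subalgebra_def)
  then obtain N z where N: "lie_subalgebra br N" "N \<subset> L" "z \<in> transporter N N"
    and "L = span (insert z N)"
    using codim_one_subalgebra[OF L(1,3)] by blast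
  then have "{br x y | x y. x \<in> L \<and> y \<in> L} \<subseteq> N"
    using br_span_insert_normalizing[OF N(1,3)] by blast
  then have "derived L \<subseteq> N"
    using N(1) by (intro span_minimal) (auto simp: lie_subalgebra_def)
  then show ?thesis using N(2) by blast
qed

lemma derived_series_subalgebra:
  assumes "lie_subalgebra br S"
  shows "lie_subalgebra br (derived_series br S i) \<and> derived_series br S i \<subseteq> S"
proof (induction i)
  case (Suc i)
  then show ?case using lie_subalgebra_derived[of "derived_series br S i"] by auto
qed (use assms in simp)

lemma solvable_if_perfect_subalgebras_trivial:
  assumes S: "lie_subalgebra br S"
    and trivial: "\<And>P. lie_subalgebra br P \<Longrightarrow> P \<subseteq> S \<Longrightarrow> derived P = P \<Longrightarrow> P = {0}"
  shows "solvable_lie br S"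
proof -
  let ?S = "derived_series br S"
  have subalgebra: "lie_subalgebra br (?S i)" "?S i \<subseteq> S" for i
    using derived_series_subalgebra[OF S] by auto
  obtain i where "\<forall>j. dim (?S i) \<le> dim (?S j)"
    using ex_has_least_nat[of "\<lambda>_. True" 0 "\<lambda>i. dim (?S i)"] by blast
  then have "dim (?S i) \<le> dim (?S (Suc i))" ..
  then have "dim (?S i) \<le> dim (derived (?S i))" by simp
  then have "derived (?S i) = ?S i"
    using subalgebra[of i] lie_subalgebra_derived[OF subalgebra(1)]
    by (intro subspace_dim_equal) (auto simp: lie_subalgebra_def)
  then have "?S i = {0}" using trivial subalgebra by blast
  then show ?thesis by (auto simp: solvable_lie_def)
qed

lemma cartan_solvable:
  assumes S: "lie_subalgebra br S" and isotropic: "\<And>u v. u \<in> S \<Longrightarrow> v \<in> S \<Longrightarrow> trace_form u v = 0"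
  shows "solvable_lie br S"
proof (rule solvable_if_perfect_subalgebras_trivial[OF S])
  fix P assume P: "lie_subalgebra br P" "P \<subseteq> S" "derived P = P"
  have "nilpotent_map (br x)" if "x \<in> P" for x
  proof (rule adjoint.real_cartan_nilpotency[of P])
    show "x \<in> derived P" using that P(3) by simp
    show "trace_form u v = 0" if "u \<in> P" "v \<in> P" for u v
      using isotropic that P(2) by blast
  qed (use P(1) in \<open>auto simp: lie_subalgebra_def\<close>)
  then show "P = {0}" using derived_psubset_if_ad_nilpotent[OF P(1)] P(3) by blast
qed

section \<open>Semisimple Lie algebras are perfect\<close>

lemma trace_form_br: "trace_form (br x y) z = - trace_form x (br z y)"
  by (rule adjoint.real.trace_form_product)

lemma bilinear_trace_form: "bilinear trace_form"
  unfolding bilinear_def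
  by (auto intro!: linearI
      simp: adjoint.real.trace_form_def br_add br_scale real_space.tr_add real_space.tr_scale)

lemma semisimple_trace_form_nondegenerate:
  assumes K: "semisimple_lie br K"
  shows "nondegenerate_subspace trace_form K"
proof
  have sub: "subspace K" and closed: "\<And>u v. u \<in> K \<Longrightarrow> v \<in> K \<Longrightarrow> br u v \<in> K"
    using K by (auto simp: semisimple_lie_def lie_subalgebra_def)
  show "subspace K" by (rule sub)
  show "bilinear trace_form" by (rule bilinear_trace_form)
  let ?R = "{x\<in>K. \<forall>y\<in>K. trace_form x y = 0}"
  have linear: "linear (\<lambda>x. trace_form x y)" for y
    using bilinear_trace_form by (simp add: bilinear_def)
  have subR: "subspace ?R"
    using sub
    by (auto simp: subspace_def linear_0[OF linear] linear_add[OF linear] linear_scale[OF linear])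
  have "br x y \<in> ?R" if "x \<in> K" "y \<in> ?R" for x y
    using that closed linear_neg[OF linear]
    by (simp add: br_anti[of x y] trace_form_br subspace_neg[OF sub])
  then have ideal: "lie_ideal_of br K ?R" using subR by (auto simp: lie_ideal_of_def)
  then have "solvable_lie br ?R"
    using subR by (intro cartan_solvable) (auto simp: lie_ideal_of_def lie_subalgebra_def)
  then have "?R = {0}" using K ideal unfolding semisimple_lie_def by blast
  then show "x = 0" if "x \<in> K" "\<And>y. y \<in> K \<Longrightarrow> trace_form x y = 0" for x
    using that by blast
qed

lemma semisimple_center_trivial:
  assumes K: "semisimple_lie br K" and z: "z \<in> K" and central: "\<And>x. x \<in> K \<Longrightarrow> br x z = 0"
  shows "z = 0"
proof -
  have "lie_ideal_of br K (span {z})"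
    unfolding lie_ideal_of_def
  proof (intro conjI ballI)
    show "span {z} \<subseteq> K"
      using K z by (intro span_minimal) (auto simp: semisimple_lie_def lie_subalgebra_def)
    show "br x y \<in> span {z}" if "x \<in> K" "y \<in> span {z}" for x y
      using that(2) central[OF that(1)] by (auto simp: span_singleton br_scale)
  qed (rule subspace_span)
  moreover have "solvable_lie br (span {z})"
  proof -
    have "{br x y | x y. x \<in> span {z} \<and> y \<in> span {z}} = {0}"
      using span_zero by (force simp: span_singleton br_scale)
    then have "derived_series br (span {z}) (Suc 0) = {0}" by simp
    then show ?thesis unfolding solvable_lie_def by blast
  qed
  ultimately have "span {z} = {0}" using K unfolding semisimple_lie_def by blast
  then show ?thesis using span_base by blast
qed

lemma semisimple_perfect:
  assumes K: "semisimple_lie br K"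
  shows "derived K = K"
proof (rule ccontr)
  assume neq: "derived K \<noteq> K"
  interpret nondegenerate_subspace trace_form K by (rule semisimple_trace_form_nondegenerate[OF K])
  have S: "lie_subalgebra br K" using K by (simp add: semisimple_lie_def)
  have "span (derived K) \<subset> span K"
    unfolding span_span span_eq_iff[THEN iffD2, OF subspace]
    using lie_subalgebra_derived(1)[OF S] neq by blast
  then obtain p where p: "p \<noteq> 0" "p \<in> span K" "\<And>y. y \<in> span (derived K) \<Longrightarrow> orthogonal p y"
    using orthogonal_to_subspace_exists_gen by blast
  obtain z where z: "z \<in> K" "\<And>y. y \<in> K \<Longrightarrow> trace_form z y = p \<bullet> y"
    using represents_functional[OF bounded_linear.linear[OF bounded_linear_inner_right]] by blast
  have "br x z = 0" if x: "x \<in> K" for x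
  proof (rule nondegenerate)
    show "br x z \<in> K" using S x z(1) by (auto simp: lie_subalgebra_def)
    fix y assume y: "y \<in> K"
    have "br y x \<in> derived K" using x y by (intro span_base) auto
    then have "p \<bullet> br y x = 0" using p(3) span_base unfolding orthogonal_def by blast
    moreover have "br y x \<in> K" using S x y by (auto simp: lie_subalgebra_def)
    ultimately show "trace_form (br x z) y = 0"
      using z(2) by (simp add: br_anti[of x z] form_simps trace_form_br)
  qed
  then have "z = 0" using semisimple_center_trivial[OF K z(1)] by blast
  moreover have "p \<in> K" using p(2) by (simp add: span_eq_iff[THEN iffD2, OF subspace])
  ultimately have "p \<bullet> p = 0" using z(2)[of p] by (simp add: form_simps)
  then show False using p(1) by simp
qed

lemma perfect_ideal_stable:
  assumes I: "lie_ideal_of br K I" "derived I = I"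
    and F: "\<And>a. a \<in> I \<Longrightarrow> br a F \<in> K" and E: "E \<in> I"
  shows "br E F \<in> I"
proof -
  have sub: "subspace I" and ideal: "\<And>x y. x \<in> K \<Longrightarrow> y \<in> I \<Longrightarrow> br x y \<in> I"
    using I(1) by (auto simp: lie_ideal_of_def)
  have "E \<in> derived I" using I(2) E by simp
  then show ?thesis
  proof (induction rule: span_induct_alt)
    case base
    show ?case by (simp add: br_zero subspace_0[OF sub])
  next
    case (step c y z)
    then obtain a b where ab: "y = br a b" "a \<in> I" "b \<in> I" by auto
    have "br y F = br (br a F) b - br (br b F) a"
      using br_leibniz[of a b F] br_anti[of a "br b F"] br_anti[of b "br a F"]
      by (simp add: ab(1) algebra_simps)
    moreover have "br (br a F) b - br (br b F) a \<in> I"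
      using ideal F ab by (intro subspace_diff[OF sub]) auto
    ultimately have "br y F \<in> I" by simp
    then show ?case
      using step.IH by (simp add: br_add br_scale subspace_add[OF sub] subspace_scale[OF sub])
  qed
qed

end

section \<open>Conformal endomorphisms of a plane\<close>

definition conformal_endo ::
  "('a::real_vector \<Rightarrow> 'a \<Rightarrow> real) \<Rightarrow> 'a set \<Rightarrow> real \<Rightarrow> ('a \<Rightarrow> 'a) \<Rightarrow> bool" where
  "conformal_endo g m c A \<longleftrightarrow> linear A \<and> (\<forall>x\<in>m. A x \<in> m) \<and>
     (\<forall>x\<in>m. \<forall>y\<in>m. g (A x) y + g (A y) x = 2 * c * g x y)"

abbreviation skew_endo :: "('a::real_vector \<Rightarrow> 'a \<Rightarrow> real) \<Rightarrow> 'a set \<Rightarrow> ('a \<Rightarrow> 'a) \<Rightarrow> bool" where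
  "skew_endo g m \<equiv> conformal_endo g m 0"

locale nondegenerate_plane = nondegenerate_subspace g m
  for g :: "'a::euclidean_space \<Rightarrow> 'a \<Rightarrow> real" and m +
  assumes symmetric: "g x y = g y x" and dim_eq_2: "dim m = 2"
begin

lemma plane_coordinates:
  obtains e f a b where "e \<in> m" "f \<in> m" "\<And>x. x \<in> m \<Longrightarrow> x = a x *\<^sub>R e + b x *\<^sub>R f"
proof -
  obtain C where C: "C \<subseteq> m" "m \<subseteq> span C" "card C = 2"
    using basis_exists[of m] dim_eq_2 by metis
  obtain e f where ef: "C = {e, f}" using C(3) by (auto simp: card_2_iff)
  have "\<exists>a b. x = a *\<^sub>R e + b *\<^sub>R f" if "x \<in> m" for x
  proof -
    have "x \<in> span {e, f}" using that C(2) ef by blast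
    then obtain a b where "x - a *\<^sub>R e = b *\<^sub>R f"
      by (auto simp: span_breakdown_eq span_singleton)
    then have "x = a *\<^sub>R e + b *\<^sub>R f" by (simp add: algebra_simps)
    then show ?thesis by blast
  qed
  then obtain a b where "\<And>x. x \<in> m \<Longrightarrow> x = a x *\<^sub>R e + b x *\<^sub>R f" by metis
  then show ?thesis using that C(1) ef by blast
qed

lemma skew_endos_multiples_of_area_form:
  "\<exists>\<omega>. \<forall>S. skew_endo g m S \<longrightarrow> (\<exists>s. \<forall>x\<in>m. \<forall>y\<in>m. g (S x) y = s * \<omega> x y)"
proof -
  obtain e f a b where ef: "e \<in> m" "f \<in> m" and coord: "\<And>x. x \<in> m \<Longrightarrow> x = a x *\<^sub>R e + b x *\<^sub>R f"
    using plane_coordinates by metis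
  have "g (S x) y = g (S e) f * (a x * b y - b x * a y)"
    if "skew_endo g m S" "x \<in> m" "y \<in> m" for S x y
  proof -
    have lin: "linear S" and skew: "\<And>x y. x \<in> m \<Longrightarrow> y \<in> m \<Longrightarrow> g (S x) y + g (S y) x = 0"
      using that(1) by (auto simp: conformal_endo_def)
    have "g (S e) e = 0" "g (S f) f = 0" "g (S f) e = - g (S e) f"
      using skew[OF ef(1) ef(1)] skew[OF ef(2) ef(2)] skew[OF ef] by auto
    moreover have "g (S x) y = g (S (a x *\<^sub>R e + b x *\<^sub>R f)) (a y *\<^sub>R e + b y *\<^sub>R f)"
      using coord that(2,3) by metis
    ultimately show ?thesis
      by (simp add: linear_add[OF lin] linear_scale[OF lin] form_simps algebra_simps)
  qed
  then show ?thesis by (intro exI[of _ "\<lambda>x y. a x * b y - b x * a y"]) blast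
qed

lemma skew_endos_commute:
  assumes S: "skew_endo g m S" and S': "skew_endo g m S'" and x: "x \<in> m"
  shows "S (S' x) = S' (S x)"
proof -
  have lin: "linear S" "linear S'" and maps: "\<And>y. y \<in> m \<Longrightarrow> S y \<in> m" "\<And>y. y \<in> m \<Longrightarrow> S' y \<in> m"
    using S S' by (auto simp: conformal_endo_def)
  obtain \<omega> s s' where area: "\<And>y z. y \<in> m \<Longrightarrow> z \<in> m \<Longrightarrow> g (S y) z = s * \<omega> y z"
    "\<And>y z. y \<in> m \<Longrightarrow> z \<in> m \<Longrightarrow> g (S' y) z = s' * \<omega> y z"
    using skew_endos_multiples_of_area_form S S' by metis
  have proportional: "s' *\<^sub>R S y = s *\<^sub>R S' y" if y: "y \<in> m" for y
  proof -
    have "s' *\<^sub>R S y - s *\<^sub>R S' y = 0"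
      using maps[OF y] subspace
      by (intro nondegenerate subspace_diff subspace_scale)
        (simp_all add: form_simps area y)
    then show ?thesis by simp
  qed
  show ?thesis
  proof (cases "s = 0")
    case True
    have "S y = 0" if "y \<in> m" for y
      using area(1) maps(1) that True by (intro nondegenerate) auto
    then show ?thesis using x maps(2) linear_0[OF lin(2)] by simp
  next
    case False
    have "s *\<^sub>R S (S' x) = s' *\<^sub>R S (S x)"
      using proportional[OF x] linear_scale[OF lin(1)] by metis
    also have "\<dots> = s *\<^sub>R S' (S x)" by (rule proportional[OF maps(1)[OF x]])
    finally show ?thesis using False by simp
  qed
qed

lemma skew_part_of_conformal_endo:
  assumes "conformal_endo g m c A"
  shows "skew_endo g m (\<lambda>x. A x - c *\<^sub>R x)"
  unfolding conformal_endo_def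
proof (intro conjI ballI)
  have A: "linear A" "\<And>x. x \<in> m \<Longrightarrow> A x \<in> m"
    "\<And>x y. x \<in> m \<Longrightarrow> y \<in> m \<Longrightarrow> g (A x) y + g (A y) x = 2 * c * g x y"
    using assms by (auto simp: conformal_endo_def)
  show "linear (\<lambda>x. A x - c *\<^sub>R x)"
    by (rule linearI) (simp_all add: linear_add[OF A(1)] linear_scale[OF A(1)] algebra_simps)
  show "A x - c *\<^sub>R x \<in> m" if "x \<in> m" for x
    using that A(2) subspace by (simp add: subspace_diff subspace_scale)
  show "g (A x - c *\<^sub>R x) y + g (A y - c *\<^sub>R y) x = 2 * 0 * g x y" if "x \<in> m" "y \<in> m" for x y
    using A(3)[OF that] symmetric[of x y] by (simp add: form_simps)
qed

lemma conformal_endos_commute: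
  assumes A: "conformal_endo g m c A" and A': "conformal_endo g m c' A'" and x: "x \<in> m"
  shows "A (A' x) = A' (A x)"
proof -
  have "linear A" "linear A'" using A A' by (auto simp: conformal_endo_def)
  then show ?thesis
    using skew_endos_commute[OF skew_part_of_conformal_endo[OF A]
        skew_part_of_conformal_endo[OF A'] x]
    by (simp add: linear_diff linear_scale algebra_simps)
qed

end

section \<open>Conformal foliations\<close>

locale conformal_splitting = real_lie_algebra br
  for br :: "'a::euclidean_space \<Rightarrow> 'a \<Rightarrow> 'a" +
  fixes g :: "'a \<Rightarrow> 'a \<Rightarrow> real" and K m :: "'a set"
  assumes metric: "semi_riem_metric g"
    and subalgebra_K: "lie_subalgebra br K"
    and subspace_m: "subspace m"
    and orthogonal: "x \<in> K \<Longrightarrow> y \<in> m \<Longrightarrow> g x y = 0"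
    and splits: "\<exists>x\<in>K. \<exists>y\<in>m. z = x + y"
    and conformal: "conformal_foliation br g K m"
begin

lemma g_sym: "g x y = g y x"
  using metric by (simp add: semi_riem_metric_def)

sublocale ambient: nondegenerate_subspace g UNIV
  using metric by (rule nondegenerate_subspace_UNIV)

sublocale vertical: nondegenerate_subspace g K
proof (rule nondegenerate_subspace_if_splits[OF metric])
  show "subspace K" using subalgebra_K by (simp add: lie_subalgebra_def)
  show "\<exists>x\<in>K. \<forall>u\<in>K. g u (z - x) = 0" for z
    using splits[of z] orthogonal by force
qed

sublocale horizontal: nondegenerate_subspace g m
proof (rule nondegenerate_subspace_if_splits[OF metric subspace_m])
  show "\<exists>y\<in>m. \<forall>u\<in>m. g u (z - y) = 0" for z
    using splits[of z] orthogonal g_sym by force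
qed

lemma K_br: "x \<in> K \<Longrightarrow> y \<in> K \<Longrightarrow> br x y \<in> K"
  using subalgebra_K by (auto simp: lie_subalgebra_def)

lemma lc_nabla_koszul:
  "2 * g (lc_nabla br g X Y) W = g (br X Y) W - g (br Y W) X + g (br W X) Y"
proof -
  let ?\<phi> = "\<lambda>W. (g (br X Y) W - g (br Y W) X + g (br W X) Y) / 2"
  have "linear ?\<phi>"
    by (rule linearI) (simp_all add: ambient.form_simps br_add br_scale field_simps)
  then obtain Z where Z: "\<And>W. g Z W = ?\<phi> W"
    using ambient.represents_functional by blast
  have "lc_nabla br g X Y = Z"
    unfolding lc_nabla_def
  proof (rule the_equality)
    show "\<forall>W. 2 * g Z W = g (br X Y) W - g (br Y W) X + g (br W X) Y" by (simp add: Z)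
    fix Z' assume "\<forall>W. 2 * g Z' W = g (br X Y) W - g (br Y W) X + g (br W X) Y"
    then have "2 * g Z' W = 2 * g Z W" for W by (simp add: Z)
    then have "Z' - Z = 0" by (intro ambient.nondegenerate) (simp_all add: ambient.form_simps)
    then show "Z' = Z" by simp
  qed
  then show ?thesis by (simp add: Z)
qed

lemma conformal_ad:
  "\<exists>V. \<forall>W\<in>K. \<forall>E\<in>m. \<forall>F\<in>m. g (br W E) F + g (br W F) E = 2 * g V W * g E F"
proof -
  obtain V where V: "\<And>E F. E \<in> m \<Longrightarrow> F \<in> m \<Longrightarrow> BH br g K E F = g E F *\<^sub>R V"
    using conformal by (auto simp: conformal_foliation_def)
  have "g (br W E) F + g (br W F) E = 2 * g V W * g E F"
    if W: "W \<in> K" and EF: "E \<in> m" "F \<in> m" for W E F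
  proof -
    have "2 * (g E F * g V W) = 2 * g (BH br g K E F) W" by (simp add: V[OF EF] ambient.form_simps)
    also have "\<dots> = g (lc_nabla br g E F + lc_nabla br g F E) W"
      by (simp add: BH_def ambient.form_simps vertical.orth_proj_inner[OF W])
    also have "\<dots> = g (br W E) F + g (br W F) E"
      using lc_nabla_koszul[of E F W] lc_nabla_koszul[of F E W]
        br_anti[of F E] br_anti[of F W] br_anti[of E W]
      by (simp add: ambient.form_simps)
    finally show ?thesis by (simp add: mult_ac)
  qed
  then show ?thesis by blast
qed

lemma orth_proj_horizontal_eqI: "y \<in> m \<Longrightarrow> z - y \<in> K \<Longrightarrow> orth_proj g m z = y"
  using orthogonal[of "z - y"]
  by (intro horizontal.orth_proj_eqI) (simp_all add: ambient.form_simps)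

lemma vertical_remainder: "z - orth_proj g m z \<in> K"
proof -
  obtain x y where "x \<in> K" "y \<in> m" "z = x + y" using splits[of z] by blast
  then show ?thesis using orth_proj_horizontal_eqI[of y z] by simp
qed

lemma orth_proj_horizontal_eq_0_iff: "orth_proj g m z = 0 \<longleftrightarrow> z \<in> K"
  using orth_proj_horizontal_eqI[of 0 z] vertical_remainder[of z] subspace_0[OF subspace_m] by auto

definition bott_connection :: "'a \<Rightarrow> 'a \<Rightarrow> 'a" where
  "bott_connection W x = orth_proj g m (br W x)"

lemma linear_bott_connection: "linear (bott_connection W)"
  and linear_bott_connection_left: "linear (\<lambda>W. bott_connection W x)"
  unfolding bott_connection_def
  using linear_compose[OF linear_ad horizontal.linear_orth_proj]
    linear_compose[OF linear_br_left horizontal.linear_orth_proj]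
  by (simp_all add: comp_def)

lemma bott_connection_br:
  assumes "W \<in> K" "W' \<in> K"
  shows "bott_connection (br W W') x
    = bott_connection W (bott_connection W' x) - bott_connection W' (bott_connection W x)"
proof -
  have iterate: "bott_connection U (bott_connection U' x) = orth_proj g m (br U (br U' x))"
    if "U \<in> K" for U U'
  proof -
    have "br U (br U' x - bott_connection U' x) \<in> K"
      unfolding bott_connection_def by (rule K_br[OF that vertical_remainder])
    then have "orth_proj g m (br U (br U' x)) - bott_connection U (bott_connection U' x) = 0"
      by (simp add: bott_connection_def br_diff orth_proj_horizontal_eq_0_iff
          linear_diff[OF horizontal.linear_orth_proj, symmetric])
    then show ?thesis by simp
  qed
  have "br (br W W') x = br W (br W' x) - br W' (br W x)" using br_leibniz[of W W' x] by simp
  then show ?thesis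
    by (simp add: iterate assms bott_connection_def[of "br W W'"]
        linear_diff[OF horizontal.linear_orth_proj])
qed

lemma bott_connection_commute:
  assumes dim: "dim m = 2" and W: "W \<in> K" "W' \<in> K" and x: "x \<in> m"
  shows "bott_connection W (bott_connection W' x) = bott_connection W' (bott_connection W x)"
proof -
  interpret nondegenerate_plane g m by unfold_locales (rule g_sym dim)+
  obtain V where V: "\<And>W E F. W \<in> K \<Longrightarrow> E \<in> m \<Longrightarrow> F \<in> m \<Longrightarrow>
      g (br W E) F + g (br W F) E = 2 * g V W * g E F"
    using conformal_ad by blast
  have "conformal_endo g m (g V U) (bott_connection U)" if "U \<in> K" for U
    using V[OF that] linear_bott_connection
    by (simp add: conformal_endo_def bott_connection_def
        horizontal.orth_proj_mem horizontal.orth_proj_inner)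
  then show ?thesis using conformal_endos_commute W x by blast
qed

lemma derived_maps_horizontal_to_vertical:
  assumes "dim m = 2" "W \<in> derived K" "x \<in> m"
  shows "br W x \<in> K"
proof -
  have "bott_connection W x = 0"
  proof (rule linear_eq_0_on_span[OF linear_bott_connection_left _ assms(2)])
    show "bott_connection U x = 0" if "U \<in> {br a b | a b. a \<in> K \<and> b \<in> K}" for U
      using that bott_connection_br bott_connection_commute[OF assms(1) _ _ assms(3)] by auto
  qed
  then show ?thesis by (simp add: bott_connection_def orth_proj_horizontal_eq_0_iff)
qed

end

section \<open>Sums of commuting subalgebras\<close>

lemma sum_spaces_orthogonal:
  assumes "bilinear g" "\<And>j x. j < n \<Longrightarrow> x \<in> k j \<Longrightarrow> g x y = 0" "x \<in> sum_spaces k n"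
  shows "g x y = 0"
  using assms by (auto simp: sum_spaces_def bilinear_def linear_sum[of "\<lambda>x. g x y"])

lemma nondegenerate_orthogonal_summand:
  fixes g :: "'a::euclidean_space \<Rightarrow> 'a \<Rightarrow> real" and k :: "nat \<Rightarrow> 'a set"
  assumes g: "semi_riem_metric g" and j: "j < n" "subspace (k j)"
    and orth_kk: "\<And>i x y. i < n \<Longrightarrow> i \<noteq> j \<Longrightarrow> x \<in> k j \<Longrightarrow> y \<in> k i \<Longrightarrow> g x y = 0"
    and orth_km: "\<And>x y. x \<in> k j \<Longrightarrow> y \<in> m \<Longrightarrow> g x y = 0"
    and spans: "\<And>z. \<exists>xs y. (\<forall>i<n. xs i \<in> k i) \<and> y \<in> m \<and> z = (\<Sum>i<n. xs i) + y"
  shows "nondegenerate_subspace g (k j)"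
proof (rule nondegenerate_subspace_if_splits[OF g j(2)])
  interpret nondegenerate_subspace g UNIV using g by (rule nondegenerate_subspace_UNIV)
  fix z
  obtain xs y where z: "\<forall>i<n. xs i \<in> k i" "y \<in> m" "z = (\<Sum>i<n. xs i) + y" using spans[of z] by blast
  then have "z - xs j = (\<Sum>i\<in>{..<n} - {j}. xs i) + y"
    using j(1) by (simp add: sum.remove)
  moreover have "g u (xs i) = 0" if "u \<in> k j" "i \<in> {..<n} - {j}" for u i
    using that z(1) by (intro orth_kk) auto
  ultimately have "g u (z - xs j) = 0" if "u \<in> k j" for u
    using that orth_km[OF _ z(2)] by (simp add: form_simps)
  then show "\<exists>x\<in>k j. \<forall>u\<in>k j. g u (z - x) = 0" using z(1) j(1) by blast
qed

locale commuting_subalgebras = real_lie_algebra br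
  for br :: "'a::euclidean_space \<Rightarrow> 'a \<Rightarrow> 'a" +
  fixes k :: "nat \<Rightarrow> 'a set" and n :: nat
  assumes subalgebra: "j < n \<Longrightarrow> lie_subalgebra br (k j)"
    and commuting: "i < n \<Longrightarrow> j < n \<Longrightarrow> i \<noteq> j \<Longrightarrow> x \<in> k i \<Longrightarrow> y \<in> k j \<Longrightarrow> br x y = 0"
begin

lemma summand_subset:
  assumes "l < n" shows "k l \<subseteq> sum_spaces k n"
proof
  fix x assume "x \<in> k l"
  let ?xs = "\<lambda>j. if j = l then x else 0"
  have "\<forall>j<n. ?xs j \<in> k j" "x = (\<Sum>j<n. ?xs j)"
    using \<open>x \<in> k l\<close> assms subalgebra by (auto simp: lie_subalgebra_def subspace_0)
  then show "x \<in> sum_spaces k n" unfolding sum_spaces_def by blast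
qed

lemma br_sum_summand:
  assumes l: "l < n" and xs: "\<forall>j<n. xs j \<in> k j" and y: "y \<in> k l"
  shows "br (\<Sum>j<n. xs j) y = br (xs l) y"
proof -
  have "br (\<Sum>j<n. xs j) y = (\<Sum>j<n. br (xs j) y)" by (rule br_sum(1))
  also have "\<dots> = (\<Sum>j<n. if j = l then br (xs l) y else 0)"
    using commuting[OF _ l _ _ y] xs by (intro sum.cong) auto
  finally show ?thesis using l by simp
qed

lemma ideal_of_summand:
  assumes l: "l < n" and I: "lie_ideal_of br (k l) I"
  shows "lie_ideal_of br (sum_spaces k n) I"
proof -
  have "br x y \<in> I" if x: "x \<in> sum_spaces k n" and y: "y \<in> I" for x y
  proof -
    obtain xs where "\<forall>j<n. xs j \<in> k j" "x = (\<Sum>j<n. xs j)" using x by (auto simp: sum_spaces_def)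
    then show ?thesis using br_sum_summand[OF l] I l y by (auto simp: lie_ideal_of_def)
  qed
  then show ?thesis using I summand_subset[OF l] by (auto simp: lie_ideal_of_def)
qed

lemma summand_perfect:
  assumes "semisimple_lie br (sum_spaces k n)" "l < n"
  shows "derived (k l) = k l"
  using assms ideal_of_summand subalgebra
  by (intro semisimple_perfect) (auto simp: semisimple_lie_def)

lemma summand_stable:
  assumes semisimple: "semisimple_lie br (sum_spaces k n)" and l: "l < n"
    and F: "\<And>a. a \<in> k l \<Longrightarrow> br a F \<in> sum_spaces k n" and E: "E \<in> k l"
  shows "br E F \<in> k l"
proof (rule perfect_ideal_stable[OF _ summand_perfect[OF semisimple l] F E])
  show "lie_ideal_of br (sum_spaces k n) (k l)"
    using subalgebra[OF l]
    by (intro ideal_of_summand[OF l]) (auto simp: lie_ideal_of_def lie_subalgebra_def)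
qed

end

theorem theorem6p2:
  fixes br :: "'a::euclidean_space \<Rightarrow> 'a \<Rightarrow> 'a"
    and g :: "'a \<Rightarrow> 'a \<Rightarrow> real"
    and k :: "nat \<Rightarrow> 'a set" and m :: "'a set" and n :: nat
  assumes lie: "lie_algebra br"
    and metric: "semi_riem_metric g"
    and sub: "\<And>j. j < n \<Longrightarrow> lie_subalgebra br (k j)"
    and prod: "\<And>i j x y. i < n \<Longrightarrow> j < n \<Longrightarrow> i \<noteq> j \<Longrightarrow> x \<in> k i \<Longrightarrow> y \<in> k j \<Longrightarrow> br x y = 0"
    and semisimple: "semisimple_lie br (sum_spaces k n)"
    and m_sub: "subspace m" and m_dim: "dim m = 2"
    and orth_kk: "\<And>i j x y. i < n \<Longrightarrow> j < n \<Longrightarrow> i \<noteq> j \<Longrightarrow> x \<in> k i \<Longrightarrow> y \<in> k j \<Longrightarrow> g x y = 0"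
    and orth_km: "\<And>j x y. j < n \<Longrightarrow> x \<in> k j \<Longrightarrow> y \<in> m \<Longrightarrow> g x y = 0"
    and spans: "\<And>z. \<exists>xs y. (\<forall>j<n. xs j \<in> k j) \<and> y \<in> m \<and> z = (\<Sum>j<n. xs j) + y"
    and direct: "\<And>xs y. (\<forall>j<n. xs j \<in> k j) \<Longrightarrow> y \<in> m \<Longrightarrow> (\<Sum>j<n. xs j) + y = 0 \<Longrightarrow>
                   (\<forall>j<n. xs j = 0) \<and> y = 0"
    and conformal: "conformal_foliation br g (sum_spaces k n) m"
  shows "\<forall>j<n. \<forall>l<n. j \<noteq> l \<longrightarrow> (\<forall>E\<in>k l. \<forall>F\<in>m. orth_proj g (k j) (br E F) = 0)"
proof (intro allI impI ballI)
  let ?K = "sum_spaces k n"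
  interpret commuting_subalgebras br k n
    by unfold_locales (rule lie sub prod; assumption)+
  interpret conformal_splitting br g ?K m
  proof unfold_locales
    show "g x y = 0" if "x \<in> ?K" "y \<in> m" for x y
      using sum_spaces_orthogonal[of g n k y x] orth_km metric that
      by (auto simp: semi_riem_metric_def)
    show "\<exists>x\<in>?K. \<exists>y\<in>m. z = x + y" for z
      using spans[of z] by (auto simp: sum_spaces_def)
  qed (use metric semisimple m_sub conformal in \<open>auto simp: semisimple_lie_def\<close>)
  fix j l E F assume j: "j < n" and l: "l < n" and "j \<noteq> l" and E: "E \<in> k l" and F: "F \<in> m"
  interpret nondegenerate_subspace g "k j"
    using sub[OF j] j orth_kk orth_km spans
    by (intro nondegenerate_orthogonal_summand[OF metric, of j n k m])
      (auto simp: lie_subalgebra_def)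
  have "br a F \<in> ?K" if "a \<in> k l" for a
    using derived_maps_horizontal_to_vertical[OF m_dim _ F] semisimple_perfect[OF semisimple]
      summand_subset[OF l] that by blast
  then have "br E F \<in> k l" by (rule summand_stable[OF semisimple l _ E])
  then show "orth_proj g (k j) (br E F) = 0"
    using orth_kk j l \<open>j \<noteq> l\<close> by (auto simp: orth_proj_eq_0_iff)
qed

end
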